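(* Let $(\rho,\mathbf{u},\theta,\mathbf{B})$, with $\rho>0$ and $\theta>0$, be a sufficiently smooth solution in $\Omega\times(0,T)$ of the regularized magnetic gas dynamics (MGD) system of equations written in the context, and let $s$ be the entropy. (1) The following entropy balance equation holds: $$\partial_t(\rho s)+\operatorname{div}[\rho s(\mathbf{u}-\mathbf{w})]=\operatorname{div}\left(-\frac{\mathbf{q}}{\theta}\right)+\frac{1}{\theta}\,\Xi,$$ where the entropy production $\frac1\theta\Xi$ is expressed by $$\Xi=\Xi_{NS,0}+\frac{\rho}{\tau}|\widehat{\mathbf{w}}|^2+\frac{\tau p_\rho}{\rho}[\operatorname{div}(\rho\mathbf{u})]^2+\frac{\tau\rho\varepsilon_\theta}{\theta}\left(\frac{\theta p_\theta}{\rho\varepsilon_\theta}\operatorname{div}\mathbf{u}+\mathbf{u}\cdot\nabla\theta-\frac{Q}{2\rho\varepsilon_\theta}\right)^2$$ $$+\tau|\boldsymbol\beta|^2+(\mathbf{B}\cdot\mathbf{u})\,\boldsymbol\beta\cdot\nabla\tau+Q\left(1-\frac{\tau Q}{4\rho\theta\varepsilon_\theta}\right),$$ with $\frac1\theta\Xi_{NS,0}$ being the Navier–Stokes entropy production for $Q=0$: $$\Xi_{NS,0}=2\mu\sum_{i,j=1}^n\mathbb{D}_{ij}\mathbb{D}_{ij}+\left(\lambda-\tfrac23\mu\right)(\operatorname{div}\mathbf{u})^2+\frac{\varkappa}{\theta}|\nabla\theta|^2,\qquad \Xi_{NS,0}\geqslant0\ \text{ for } n=1,2,3,$$ where $\mathbb{D}_{ij}$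 are the entries of $\mathbb{D}(\mathbf{u})$. (2) Provided that $p_\rho>0$, the entropy production can also be expressed by $$\Xi=\Xi_{NS,0}+\frac{\rho}{\tau}|\widehat{\mathbf{w}}|^2+\frac{\tau}{\rho C_s^2}\left(\rho C_s^2\operatorname{div}\mathbf{u}+\mathbf{u}\cdot\nabla p-\frac{p_\theta Q}{2\rho\varepsilon_\theta}\right)^2+\frac{\tau\rho\theta}{c_p}\left(\mathbf{u}\cdot\nabla s-\frac{Q}{2\rho\theta}\right)^2$$ $$+\tau|\boldsymbol\beta|^2+(\mathbf{B}\cdot\mathbf{u})\,\boldsymbol\beta\cdot\nabla\tau+Q\left(1-\frac{\tau Q}{4\rho\theta\varepsilon_\theta}\right),$$ where $c_p$ and $c_v=\varepsilon_\theta$ are the specific heats of the gas at constant pressure and at constant volume, related by $\dfrac{C_s^2}{p_\rho}=\dfrac{c_p}{c_v}$. (3) Under the conditions $$\tau=\mathrm{const},\qquad \frac{\tau Q}{4\rho\theta\varepsilon_\theta}\leqslant1,$$ the entropy production is nonnegative: $\frac1\theta\Xi\geqslant0$ for $n=1,2,3$.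
   Context: **Setting and notation.** $\Omega$ is a domain in $\mathbb{R}^n$, $n\geqslant1$, and $(x,t)\in\Omega\times(0,T)$. The unknowns are the gas density $\rho>0$, velocity $\mathbf{u}=(u_1,\dots,u_n)$, absolute temperature $\theta>0$ and magnetic field $\mathbf{B}=(B_1,\dots,B_n)$. All functions are assumed smooth enough that all derivatives appearing exist and are continuous. $\operatorname{div}$ and $\nabla=(\partial_1,\dots,\partial_n)$ act in $x$; the divergence of a tensor is taken with respect to its first index, $(\operatorname{div}A)_j=\sum_i\partial_iA_{ij}$; $(\mathbf{a}\otimes\mathbf{b})_{ij}=a_ib_j$; $(A\mathbf{u})_i=\sum_jA_{ij}u_j$; $\nabla\mathbf{u}=\{\partial_iu_j\}_{i,j=1}^n$; $\mathbb{I}$ is the identity tensor of order $n$. **State equations.** The pressure $p=p(\rho,\theta)$ and the specific internal energy $\varepsilon=\varepsilon(\rho,\theta)$ are given functions satisfying the Maxwell relation $p=\theta p_\theta+\rho^2\varepsilon_\rho$ and the conditions $p_\rho\geqslant0$, $\varepsilon_\theta>0$ (subscripts $\rho,\theta$ on $p$ and $\varepsilon$ denote partial derivatives of these state functions). The total non-magnetic energy is $E=\frac12\rho|\mathbf{u}|^2+\rho\varepsilon$. **Entropy.** The entropy $s=s(\rho,\varepsilon)$ is introduced by the Gibbs formulas (partial derivatives in the variables $(\rho,\varepsilon)$) $$s_\rho=-\frac{p}{\rho^2\theta},\qquad s_\varepsilon=\frac1\theta.$$ **Other data.** $\mathbf{F}=\mathbf{F}(x,t)$ is the given density of body forces, $Q=Q(x,t)\geqslant0$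 the given power of heat sources, $\varkappa=\varkappa(\rho,\theta)\geqslant0$ the heat conductivity coefficient, and $\mu=\mu(\rho,\theta)\geqslant0$, $\lambda=\lambda(\rho,\theta)\geqslant0$ the viscosity coefficients. The Navier–Stokes viscous stress tensor is $$\Pi_{NS}=\mu\left[2\mathbb{D}(\mathbf{u})-\tfrac23(\operatorname{div}\mathbf{u})\mathbb{I}\right]+\lambda(\operatorname{div}\mathbf{u})\mathbb{I},\qquad \mathbb{D}(\mathbf{u})=\tfrac12(\nabla\mathbf{u}+\nabla\mathbf{u}^T).$$ The relaxation parameter is a given function $\tau=\tau(\rho,\varepsilon,\mathbf{u},\mathbf{B})>0$; $\nabla\tau$ denotes the spatial gradient of the composite function of $(x,t)$. **Regularized MGD system.** $$\partial_t\rho+\operatorname{div}[\rho(\mathbf{u}-\mathbf{w})]=0,$$ $$\partial_t(\rho\mathbf{u})+\operatorname{div}[\rho(\mathbf{u}-\mathbf{w})\otimes\mathbf{u}-\mathbf{B}\otimes\mathbf{B}]+\nabla\left(p+\tfrac12|\mathbf{B}|^2\right)=\operatorname{div}\Pi+[\rho-\tau\operatorname{div}(\rho\mathbf{u})]\mathbf{F},$$ $$\partial_t\left(E+\tfrac12|\mathbf{B}|^2\right)+\operatorname{div}\left[(E+p)(\mathbf{u}-\mathbf{w})+|\mathbf{B}|^2(\mathbf{u}-\widehat{\mathbf{w}})-((\mathbf{u}-\widehat{\mathbf{w}})\cdot\mathbf{B})\mathbf{B}\right]=\operatorname{div}\left[-\mathbf{q}+\tau(\boldsymbol\beta\cdot\mathbf{B})\mathbf{u}+\Pi\mathbf{u}\right]+\rho(\mathbf{u}-\mathbf{w})\cdot\mathbf{F}+Q,$$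 $$\partial_t\mathbf{B}+\operatorname{div}[(\mathbf{u}-\widehat{\mathbf{w}})\otimes\mathbf{B}-\mathbf{B}\otimes(\mathbf{u}-\widehat{\mathbf{w}})]=\operatorname{div}[\tau(\mathbf{u}\otimes\boldsymbol\beta-\boldsymbol\beta\otimes\mathbf{u})],\qquad \operatorname{div}\mathbf{B}=0,$$ where $$\mathbf{w}=\frac{\tau}{\rho}\left[\operatorname{div}(\rho\mathbf{u}\otimes\mathbf{u}-\mathbf{B}\otimes\mathbf{B})+\nabla\left(p+\tfrac12|\mathbf{B}|^2\right)-\rho\mathbf{F}\right],$$ $$\widehat{\mathbf{w}}=\frac{\tau}{\rho}\left[\rho(\mathbf{u}\cdot\nabla)\mathbf{u}-\operatorname{div}(\mathbf{B}\otimes\mathbf{B})+\nabla\left(p+\tfrac12|\mathbf{B}|^2\right)-\rho\mathbf{F}\right],$$ $$\Pi=\Pi_{NS}+\rho\mathbf{u}\otimes\widehat{\mathbf{w}}-\tau(\boldsymbol\beta\otimes\mathbf{B}+\mathbf{B}\otimes\boldsymbol\beta)+\tau\left(\mathbf{u}\cdot\nabla p+\rho C_s^2\operatorname{div}\mathbf{u}+\boldsymbol\beta\cdot\mathbf{B}-\frac{p_\theta}{\rho\varepsilon_\theta}Q\right)\mathbb{I},$$ $$C_s^2=p_\rho+\frac{\theta p_\theta^2}{\rho^2\varepsilon_\theta}\quad(C_s\geqslant0\text{ is the speed of sound}),$$ $$-\mathbf{q}=\varkappa\nabla\theta+\tau\left[\rho\left(\mathbf{u}\cdot\nabla\varepsilon-\frac{p}{\rho^2}\,\mathbf{u}\cdot\nabla\rho\right)-Q\right]\mathbf{u},\qquad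 \boldsymbol\beta=\operatorname{div}(\mathbf{u}\otimes\mathbf{B}-\mathbf{B}\otimes\mathbf{u}).$$ The specific heat $c_p$ may be taken as defined by $c_p=\varepsilon_\theta C_s^2/p_\rho$ when $p_\rho>0$. *)

theory Defs
  imports "HOL-Analysis.Analysis"
begin

definition pd :: "'a::real_normed_vector \<Rightarrow> ('a \<Rightarrow> real) \<Rightarrow> 'a \<Rightarrow> real" where
  "pd b f z = deriv (\<lambda>h. f (z + h *\<^sub>R b)) 0"

definition C1_along :: "'a::real_normed_vector set \<Rightarrow> 'a set \<Rightarrow> ('a \<Rightarrow> real) \<Rightarrow> bool" where
  "C1_along dirs S f \<longleftrightarrow> continuous_on S f \<and>
     (\<forall>b\<in>dirs. (\<forall>z\<in>S. (\<lambda>h. f (z + h *\<^sub>R b)) differentiable (at 0)) \<and> continuous_on S (pd b f))"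

definition C1_on :: "'a::euclidean_space set \<Rightarrow> ('a \<Rightarrow> real) \<Rightarrow> bool" where
  "C1_on S f \<longleftrightarrow> C1_along Basis S f"

definition C2_on :: "'a::euclidean_space set \<Rightarrow> ('a \<Rightarrow> real) \<Rightarrow> bool" where
  "C2_on S f \<longleftrightarrow> C1_on S f \<and> (\<forall>b\<in>Basis. C1_on S (pd b f))"

text \<open>A point of space-time is a pair \<open>z = (x, t)\<close>; all operators except \<open>ddt\<close> and \<open>ddt_vec\<close>
  act in \<open>x\<close> only.\<close>

type_synonym 'n point = "(real^'n) \<times> real"

definition space_dir :: "'n::finite \<Rightarrow> 'n point" where
  "space_dir i = (axis i 1, 0)"

definition ddx :: "'n::finite \<Rightarrow> ('n point \<Rightarrow> real) \<Rightarrow> 'n point \<Rightarrow> real" where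
  "ddx i f z = pd (space_dir i) f z"

definition ddt :: "('n::finite point \<Rightarrow> real) \<Rightarrow> 'n point \<Rightarrow> real" where
  "ddt f z = pd (0, 1) f z"

definition ddt_vec :: "('n::finite point \<Rightarrow> real^'n) \<Rightarrow> 'n point \<Rightarrow> real^'n" where
  "ddt_vec v z = (\<chi> j. ddt (\<lambda>y. v y $ j) z)"

definition grad :: "('n::finite point \<Rightarrow> real) \<Rightarrow> 'n point \<Rightarrow> real^'n" where
  "grad f z = (\<chi> i. ddx i f z)"

definition grad_vec :: "('n::finite point \<Rightarrow> real^'n) \<Rightarrow> 'n point \<Rightarrow> real^'n^'n" where
  "grad_vec v z = (\<chi> i j. ddx i (\<lambda>y. v y $ j) z)"

definition dvg :: "('n::finite point \<Rightarrow> real^'n) \<Rightarrow> 'n point \<Rightarrow> real" where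
  "dvg v z = (\<Sum>i\<in>UNIV. ddx i (\<lambda>y. v y $ i) z)"

text \<open>The divergence of a tensor contracts the first index.\<close>

definition dvg_tensor :: "('n::finite point \<Rightarrow> real^'n^'n) \<Rightarrow> 'n point \<Rightarrow> real^'n" where
  "dvg_tensor A z = (\<chi> j. \<Sum>i\<in>UNIV. ddx i (\<lambda>y. A y $ i $ j) z)"

text \<open>\<open>advect v a z\<close> is \<open>(a \<cdot> \<nabla>) v\<close> at \<open>z\<close>.\<close>

definition advect :: "('n::finite point \<Rightarrow> real^'n) \<Rightarrow> real^'n \<Rightarrow> 'n point \<Rightarrow> real^'n" where
  "advect v a z = (\<Sum>i\<in>UNIV. a $ i *\<^sub>R grad_vec v z $ i)"

definition outer :: "real^'n \<Rightarrow> real^'n \<Rightarrow> real^'n^'n" where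
  "outer a b = (\<chi> i j. a $ i * b $ j)"

text \<open>The state functions \<open>pres\<close>, \<open>eps\<close>, \<open>kap\<close>, \<open>mu\<close>, \<open>lam\<close> (pressure, specific internal energy,
  heat conductivity, viscosities) take the pair \<open>(\<rho>, \<theta>)\<close>; the relaxation parameter \<open>tau\<close> takes
  \<open>(\<rho>, \<epsilon>, u, B)\<close>.\<close>

record ('n::finite) mgd =
  pres :: "real \<times> real \<Rightarrow> real"
  eps :: "real \<times> real \<Rightarrow> real"
  kap :: "real \<times> real \<Rightarrow> real"
  mu :: "real \<times> real \<Rightarrow> real"
  lam :: "real \<times> real \<Rightarrow> real"
  tau :: "real \<times> real \<times> (real^'n) \<times> (real^'n) \<Rightarrow> real"
  force :: "'n point \<Rightarrow> real^'n"
  heat :: "'n point \<Rightarrow> real"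
  rho :: "'n point \<Rightarrow> real"
  vel :: "'n point \<Rightarrow> real^'n"
  temp :: "'n point \<Rightarrow> real"
  mag :: "'n point \<Rightarrow> real^'n"

text \<open>Suffix \<open>_f\<close>: the composite function of \<open>z = (x, t)\<close>. In particular \<open>pres_rho_f\<close> is the partial
  derivative of the state function, evaluated along the flow.\<close>

definition state_f :: "'n::finite mgd \<Rightarrow> 'n point \<Rightarrow> real \<times> real" where
  "state_f M z = (rho M z, temp M z)"

definition pres_f :: "'n::finite mgd \<Rightarrow> 'n point \<Rightarrow> real" where
  "pres_f M z = pres M (state_f M z)"

definition eps_f :: "'n::finite mgd \<Rightarrow> 'n point \<Rightarrow> real" where
  "eps_f M z = eps M (state_f M z)"

definition kap_f :: "'n::finite mgd \<Rightarrow> 'n point \<Rightarrow> real" where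
  "kap_f M z = kap M (state_f M z)"

definition mu_f :: "'n::finite mgd \<Rightarrow> 'n point \<Rightarrow> real" where
  "mu_f M z = mu M (state_f M z)"

definition lam_f :: "'n::finite mgd \<Rightarrow> 'n point \<Rightarrow> real" where
  "lam_f M z = lam M (state_f M z)"

definition tau_f :: "'n::finite mgd \<Rightarrow> 'n point \<Rightarrow> real" where
  "tau_f M z = tau M (rho M z, eps_f M z, vel M z, mag M z)"

definition pres_rho_f :: "'n::finite mgd \<Rightarrow> 'n point \<Rightarrow> real" where
  "pres_rho_f M z = pd (1, 0) (pres M) (state_f M z)"

definition pres_theta_f :: "'n::finite mgd \<Rightarrow> 'n point \<Rightarrow> real" where
  "pres_theta_f M z = pd (0, 1) (pres M) (state_f M z)"

definition eps_theta_f :: "'n::finite mgd \<Rightarrow> 'n point \<Rightarrow> real" where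
  "eps_theta_f M z = pd (0, 1) (eps M) (state_f M z)"

definition energy_f :: "'n::finite mgd \<Rightarrow> 'n point \<Rightarrow> real" where
  "energy_f M z = (1/2) * rho M z * (norm (vel M z))\<^sup>2 + rho M z * eps_f M z"

definition tot_pres_f :: "'n::finite mgd \<Rightarrow> 'n point \<Rightarrow> real" where
  "tot_pres_f M z = pres_f M z + (1/2) * (norm (mag M z))\<^sup>2"

definition Cs2_f :: "'n::finite mgd \<Rightarrow> 'n point \<Rightarrow> real" where
  "Cs2_f M z = pres_rho_f M z
     + temp M z * (pres_theta_f M z)\<^sup>2 / ((rho M z)\<^sup>2 * eps_theta_f M z)"

definition cv_f :: "'n::finite mgd \<Rightarrow> 'n point \<Rightarrow> real" where
  "cv_f M z = eps_theta_f M z"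

text \<open>Meaningful only where \<open>p\<^sub>\<rho> > 0\<close>.\<close>

definition cp_f :: "'n::finite mgd \<Rightarrow> 'n point \<Rightarrow> real" where
  "cp_f M z = eps_theta_f M z * Cs2_f M z / pres_rho_f M z"

definition w_reg :: "'n::finite mgd \<Rightarrow> 'n point \<Rightarrow> real^'n" where
  "w_reg M z = (tau_f M z / rho M z) *\<^sub>R
     (dvg_tensor (\<lambda>y. rho M y *\<^sub>R outer (vel M y) (vel M y) - outer (mag M y) (mag M y)) z
      + grad (tot_pres_f M) z - rho M z *\<^sub>R force M z)"

definition w_hat :: "'n::finite mgd \<Rightarrow> 'n point \<Rightarrow> real^'n" where
  "w_hat M z = (tau_f M z / rho M z) *\<^sub>R
     (rho M z *\<^sub>R advect (vel M) (vel M z) z - dvg_tensor (\<lambda>y. outer (mag M y) (mag M y)) z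
      + grad (tot_pres_f M) z - rho M z *\<^sub>R force M z)"

definition beta :: "'n::finite mgd \<Rightarrow> 'n point \<Rightarrow> real^'n" where
  "beta M z = dvg_tensor (\<lambda>y. outer (vel M y) (mag M y) - outer (mag M y) (vel M y)) z"

definition strain :: "'n::finite mgd \<Rightarrow> 'n point \<Rightarrow> real^'n^'n" where
  "strain M z = (1/2) *\<^sub>R (grad_vec (vel M) z + transpose (grad_vec (vel M) z))"

definition Pi_NS :: "'n::finite mgd \<Rightarrow> 'n point \<Rightarrow> real^'n^'n" where
  "Pi_NS M z =
     mu_f M z *\<^sub>R (2 *\<^sub>R strain M z - (2/3 * dvg (vel M) z) *\<^sub>R mat 1)
     + (lam_f M z * dvg (vel M) z) *\<^sub>R mat 1"

definition Pi_tensor :: "'n::finite mgd \<Rightarrow> 'n point \<Rightarrow> real^'n^'n" where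
  "Pi_tensor M z =
     Pi_NS M z + rho M z *\<^sub>R outer (vel M z) (w_hat M z)
     - tau_f M z *\<^sub>R (outer (beta M z) (mag M z) + outer (mag M z) (beta M z))
     + (tau_f M z *
         (vel M z \<bullet> grad (pres_f M) z + rho M z * Cs2_f M z * dvg (vel M) z
          + beta M z \<bullet> mag M z
          - pres_theta_f M z / (rho M z * eps_theta_f M z) * heat M z)) *\<^sub>R mat 1"

definition q_flux :: "'n::finite mgd \<Rightarrow> 'n point \<Rightarrow> real^'n" where
  "q_flux M z = - (kap_f M z *\<^sub>R grad (temp M) z
     + (tau_f M z *
         (rho M z * (vel M z \<bullet> grad (eps_f M) z
                     - pres_f M z / (rho M z)\<^sup>2 * (vel M z \<bullet> grad (rho M) z))
          - heat M z)) *\<^sub>R vel M z)"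

definition mass_eq :: "'n::finite mgd \<Rightarrow> 'n point \<Rightarrow> bool" where
  "mass_eq M z \<longleftrightarrow> ddt (rho M) z + dvg (\<lambda>y. rho M y *\<^sub>R (vel M y - w_reg M y)) z = 0"

definition momentum_eq :: "'n::finite mgd \<Rightarrow> 'n point \<Rightarrow> bool" where
  "momentum_eq M z \<longleftrightarrow>
     ddt_vec (\<lambda>y. rho M y *\<^sub>R vel M y) z
     + dvg_tensor (\<lambda>y. outer (rho M y *\<^sub>R (vel M y - w_reg M y)) (vel M y)
                       - outer (mag M y) (mag M y)) z
     + grad (tot_pres_f M) z
     = dvg_tensor (Pi_tensor M) z
       + (rho M z - tau_f M z * dvg (\<lambda>y. rho M y *\<^sub>R vel M y) z) *\<^sub>R force M z"

definition energy_eq :: "'n::finite mgd \<Rightarrow> 'n point \<Rightarrow> bool" where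
  "energy_eq M z \<longleftrightarrow>
     ddt (\<lambda>y. energy_f M y + (1/2) * (norm (mag M y))\<^sup>2) z
     + dvg (\<lambda>y. (energy_f M y + pres_f M y) *\<^sub>R (vel M y - w_reg M y)
                + (norm (mag M y))\<^sup>2 *\<^sub>R (vel M y - w_hat M y)
                - ((vel M y - w_hat M y) \<bullet> mag M y) *\<^sub>R mag M y) z
     = dvg (\<lambda>y. - q_flux M y + (tau_f M y * (beta M y \<bullet> mag M y)) *\<^sub>R vel M y
                + Pi_tensor M y *v vel M y) z
       + rho M z * ((vel M z - w_reg M z) \<bullet> force M z) + heat M z"

definition induction_eq :: "'n::finite mgd \<Rightarrow> 'n point \<Rightarrow> bool" where
  "induction_eq M z \<longleftrightarrow>
     ddt_vec (mag M) z
     + dvg_tensor (\<lambda>y. outer (vel M y - w_hat M y) (mag M y)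
                       - outer (mag M y) (vel M y - w_hat M y)) z
     = dvg_tensor (\<lambda>y. tau_f M y *\<^sub>R (outer (vel M y) (beta M y) - outer (beta M y) (vel M y))) z"

definition cylinder :: "(real^'n) set \<Rightarrow> real \<Rightarrow> 'n::finite point set" where
  "cylinder \<Omega> T = \<Omega> \<times> {0<..<T}"

definition state_dom :: "(real \<times> real) set" where
  "state_dom = {0<..} \<times> {0<..}"

text \<open>All values of \<open>(\<rho>, \<epsilon>)\<close> attained by states with \<open>\<rho> > 0\<close>, \<open>\<theta> > 0\<close>.\<close>

definition energy_dom :: "'n::finite mgd \<Rightarrow> (real \<times> real) set" where
  "energy_dom M = (\<lambda>(r, \<theta>). (r, eps M (r, \<theta>))) ` state_dom"

definition tau_dom :: "'n::finite mgd \<Rightarrow> (real \<times> real \<times> (real^'n) \<times> (real^'n)) set" where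
  "tau_dom M = {(r, e, v, b). (r, e) \<in> energy_dom M}"

definition state_equations :: "'n::finite mgd \<Rightarrow> bool" where
  "state_equations M \<longleftrightarrow>
     C2_on state_dom (pres M) \<and> C2_on state_dom (eps M) \<and>
     (\<forall>r>0. \<forall>\<theta>>0.
        pres M (r, \<theta>) = \<theta> * pd (0, 1) (pres M) (r, \<theta>) + r\<^sup>2 * pd (1, 0) (eps M) (r, \<theta>) \<and>
        pd (1, 0) (pres M) (r, \<theta>) \<ge> 0 \<and> pd (0, 1) (eps M) (r, \<theta>) > 0)"

definition coefficients :: "'n::finite mgd \<Rightarrow> bool" where
  "coefficients M \<longleftrightarrow>
     C1_on state_dom (kap M) \<and> C1_on state_dom (mu M) \<and> C1_on state_dom (lam M) \<and>
     (\<forall>z\<in>state_dom. kap M z \<ge> 0 \<and> mu M z \<ge> 0 \<and> lam M z \<ge> 0) \<and>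
     C1_on (tau_dom M) (tau M) \<and> (\<forall>z\<in>tau_dom M. tau M z > 0)"

text \<open>Body forces and heat sources enter the system under one spatial derivative and no time
  derivative.\<close>

definition sources :: "(real^'n) set \<Rightarrow> real \<Rightarrow> 'n::finite mgd \<Rightarrow> bool" where
  "sources \<Omega> T M \<longleftrightarrow>
     (\<forall>j. C1_along (range space_dir) (cylinder \<Omega> T) (\<lambda>z. force M z $ j)) \<and>
     C1_along (range space_dir) (cylinder \<Omega> T) (heat M) \<and>
     (\<forall>z\<in>cylinder \<Omega> T. heat M z \<ge> 0)"

text \<open>The unknowns are differentiated at most twice in \<open>x\<close> and once in \<open>t\<close>.\<close>

definition C2_space_C1_time :: "'n::finite point set \<Rightarrow> ('n point \<Rightarrow> real) \<Rightarrow> bool" where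
  "C2_space_C1_time S f \<longleftrightarrow> C1_on S f \<and> (\<forall>i. C1_along (range space_dir) S (ddx i f))"

definition mgd_solution :: "(real^'n) set \<Rightarrow> real \<Rightarrow> 'n::finite mgd \<Rightarrow> bool" where
  "mgd_solution \<Omega> T M \<longleftrightarrow>
     C2_space_C1_time (cylinder \<Omega> T) (rho M) \<and>
     C2_space_C1_time (cylinder \<Omega> T) (temp M) \<and>
     (\<forall>j. C2_space_C1_time (cylinder \<Omega> T) (\<lambda>z. vel M z $ j)) \<and>
     (\<forall>j. C2_space_C1_time (cylinder \<Omega> T) (\<lambda>z. mag M z $ j)) \<and>
     (\<forall>z\<in>cylinder \<Omega> T.
        rho M z > 0 \<and> temp M z > 0 \<and>
        mass_eq M z \<and> momentum_eq M z \<and> energy_eq M z \<and> induction_eq M z \<and>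
        dvg (mag M) z = 0)"

text \<open>Gibbs formulas: \<open>s\<close> is a function of \<open>(\<rho>, \<epsilon>)\<close>, and the right-hand sides are taken at the
  temperature \<open>\<theta>\<close> with \<open>\<epsilon> = \<epsilon>(\<rho>, \<theta>)\<close>, unique because \<open>\<epsilon>\<^sub>\<theta> > 0\<close>.\<close>

definition is_entropy :: "'n::finite mgd \<Rightarrow> (real \<times> real \<Rightarrow> real) \<Rightarrow> bool" where
  "is_entropy M s \<longleftrightarrow> C1_on (energy_dom M) s \<and>
     (\<forall>r>0. \<forall>\<theta>>0.
        pd (1, 0) s (r, eps M (r, \<theta>)) = - (pres M (r, \<theta>) / (r\<^sup>2 * \<theta>)) \<and>
        pd (0, 1) s (r, eps M (r, \<theta>)) = 1 / \<theta>)"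

definition entropy_f :: "'n::finite mgd \<Rightarrow> (real \<times> real \<Rightarrow> real) \<Rightarrow> 'n point \<Rightarrow> real" where
  "entropy_f M s z = s (rho M z, eps_f M z)"

definition Xi_NS0 :: "'n::finite mgd \<Rightarrow> 'n point \<Rightarrow> real" where
  "Xi_NS0 M z =
     2 * mu_f M z * (\<Sum>i\<in>UNIV. \<Sum>j\<in>UNIV. strain M z $ i $ j * strain M z $ i $ j)
     + (lam_f M z - 2/3 * mu_f M z) * (dvg (vel M) z)\<^sup>2
     + kap_f M z / temp M z * (norm (grad (temp M) z))\<^sup>2"

definition Xi :: "'n::finite mgd \<Rightarrow> 'n point \<Rightarrow> real" where
  "Xi M z =
     Xi_NS0 M z
     + rho M z / tau_f M z * (norm (w_hat M z))\<^sup>2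
     + tau_f M z * pres_rho_f M z / rho M z * (dvg (\<lambda>y. rho M y *\<^sub>R vel M y) z)\<^sup>2
     + tau_f M z * rho M z * eps_theta_f M z / temp M z *
         (temp M z * pres_theta_f M z / (rho M z * eps_theta_f M z) * dvg (vel M) z
          + vel M z \<bullet> grad (temp M) z
          - heat M z / (2 * rho M z * eps_theta_f M z))\<^sup>2
     + tau_f M z * (norm (beta M z))\<^sup>2
     + (mag M z \<bullet> vel M z) * (beta M z \<bullet> grad (tau_f M) z)
     + heat M z * (1 - tau_f M z * heat M z / (4 * rho M z * temp M z * eps_theta_f M z))"

end

(*
  Subtracting from the energy equation the momentum equation dotted with u and the induction
  equation dotted with B leaves a balance for the internal energy: rho * theta times the material
  derivative of s (along u - w, by the Gibbs formulas and the mass equation) equals the divergence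
  of -q plus Q, the stress power and the magnetic remainders. Three facts make the remainders
  collapse: w - w_hat is (tau/rho) div(rho u) u, which produces |w_hat|^2 and the p_rho term;
  the definition of beta turns the magnetic part into tau |beta|^2; and div beta = 0 leaves only
  (B.u) beta.grad tau. What remains is a quadratic form in div u, u.grad rho and u.grad theta,
  in which the Maxwell relation lets one complete the squares.
*)
theory Submission
  imports Defs
begin

section \<open>Directional derivatives\<close>

text \<open>\<open>pd\<close> is a bare \<open>deriv\<close> along a line and has a value even where
  no derivative exists, so every calculus rule carries the certificate \<open>pdiff\<close>. The
  data limit what may be differentiated: the sources and the space derivatives of the unknowns admit
  one further derivative, in space only. Hence the regularizing velocities, the stress and the heat
  flux are differentiated only in \<open>x\<close>, and time derivatives fall on the unknowns and on
  functions of state alone. Two points need more than product rules. The chain rule for the state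
  functions, \<open>tau\<close> and the entropy needs total differentiability on an open domain,
  which for the entropy rests on the monotonicity of the energy in temperature. And div beta = 0
  needs symmetry of mixed second derivatives. The factors 1/2 and 1/4 at Q come from completing a
  square: the Q terms placed in the stress and in the heat flux are exactly its cross terms, and the
  last summand of \<open>Xi\<close> takes back the square of Q that this creates.\<close>

definition pdiff :: "'a::real_normed_vector \<Rightarrow> ('a \<Rightarrow> real) \<Rightarrow> 'a \<Rightarrow> bool" where
  "pdiff b f z \<longleftrightarrow> (\<lambda>h. f (z + h *\<^sub>R b)) differentiable (at 0)"

lemma pdiff_has_derivative:
  assumes "pdiff b f z"
  shows "((\<lambda>h. f (z + h *\<^sub>R b)) has_real_derivative pd b f z) (at 0)"
  using assms unfolding pdiff_def pd_def
  using DERIV_deriv_iff_real_differentiable by blast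

lemma
  assumes "((\<lambda>h. f (z + h *\<^sub>R b)) has_real_derivative d) (at 0)"
  shows pd_eqI: "pd b f z = d" and pdiffI: "pdiff b f z"
  using assms DERIV_imp_deriv real_differentiable_def unfolding pdiff_def pd_def by blast+

lemma pd_const [simp]: "pd b (\<lambda>y. c) z = 0"
  and pdiff_const [simp]: "pdiff b (\<lambda>y. c) z"
  by (rule pd_eqI pdiffI, rule DERIV_const)+

lemma
  assumes "pdiff b f z" "pdiff b g z"
  shows pd_add: "pd b (\<lambda>y. f y + g y) z = pd b f z + pd b g z"
    and pdiff_add: "pdiff b (\<lambda>y. f y + g y) z"
  by (rule pd_eqI pdiffI, rule DERIV_add[OF assms[THEN pdiff_has_derivative]])+

lemma
  assumes "pdiff b f z" "pdiff b g z"
  shows pd_diff: "pd b (\<lambda>y. f y - g y) z = pd b f z - pd b g z"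
    and pdiff_diff: "pdiff b (\<lambda>y. f y - g y) z"
  by (rule pd_eqI pdiffI, rule DERIV_diff[OF assms[THEN pdiff_has_derivative]])+

lemma
  assumes "pdiff b f z"
  shows pd_minus: "pd b (\<lambda>y. - f y) z = - pd b f z"
    and pdiff_minus: "pdiff b (\<lambda>y. - f y) z"
  by (rule pd_eqI pdiffI, rule DERIV_minus[OF assms[THEN pdiff_has_derivative]])+

lemma
  assumes "pdiff b f z" "pdiff b g z"
  shows pd_mult: "pd b (\<lambda>y. f y * g y) z = pd b f z * g z + f z * pd b g z"
    and pdiff_mult: "pdiff b (\<lambda>y. f y * g y) z"
proof -
  have "((\<lambda>h. f (z + h *\<^sub>R b) * g (z + h *\<^sub>R b)) has_real_derivative
      pd b f z * g z + f z * pd b g z) (at 0)"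
    by (rule DERIV_cong[OF DERIV_mult[OF assms[THEN pdiff_has_derivative]]])
       (simp add: mult.commute)
  then show "pd b (\<lambda>y. f y * g y) z = pd b f z * g z + f z * pd b g z"
    and "pdiff b (\<lambda>y. f y * g y) z"
    by (rule pd_eqI pdiffI)+
qed

lemma
  assumes "pdiff b f z" "f z \<noteq> 0"
  shows pd_inverse: "pd b (\<lambda>y. 1 / f y) z = - pd b f z / (f z)\<^sup>2"
    and pdiff_inverse: "pdiff b (\<lambda>y. 1 / f y) z"
proof -
  have "((\<lambda>h. inverse (f (z + h *\<^sub>R b))) has_real_derivative - pd b f z / (f z)\<^sup>2) (at 0)"
    by (rule DERIV_cong[OF DERIV_inverse_fun[OF pdiff_has_derivative[OF assms(1)]]])
       (use assms(2) in \<open>simp_all add: field_simps power2_eq_square\<close>)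
  then have "((\<lambda>h. 1 / (f (z + h *\<^sub>R b))) has_real_derivative - pd b f z / (f z)\<^sup>2) (at 0)"
    by (simp add: inverse_eq_divide)
  then show "pd b (\<lambda>y. 1 / f y) z = - pd b f z / (f z)\<^sup>2"
    and "pdiff b (\<lambda>y. 1 / f y) z"
    by (rule pd_eqI pdiffI)+
qed

lemma pdiff_divide:
  assumes "pdiff b f z" "pdiff b g z" "g z \<noteq> 0"
  shows "pdiff b (\<lambda>y. f y / g y) z"
  using pdiff_mult[OF assms(1) pdiff_inverse[OF assms(2,3)]] by simp

lemma pdiff_power2:
  assumes "pdiff b f z"
  shows "pdiff b (\<lambda>y. (f y)\<^sup>2) z"
  using pdiff_mult[OF assms assms] by (simp add: power2_eq_square)

lemma
  assumes "\<And>i. i \<in> I \<Longrightarrow> pdiff b (f i) z"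
  shows pd_sum: "pd b (\<lambda>y. \<Sum>i\<in>I. f i y) z = (\<Sum>i\<in>I. pd b (f i) z)"
    and pdiff_sum: "pdiff b (\<lambda>y. \<Sum>i\<in>I. f i y) z"
proof -
  have "((\<lambda>h. \<Sum>i\<in>I. f i (z + h *\<^sub>R b)) has_real_derivative (\<Sum>i\<in>I. pd b (f i) z)) (at 0)"
    by (rule DERIV_sum) (rule pdiff_has_derivative[OF assms])
  then show "pd b (\<lambda>y. \<Sum>i\<in>I. f i y) z = (\<Sum>i\<in>I. pd b (f i) z)"
    and "pdiff b (\<lambda>y. \<Sum>i\<in>I. f i y) z"
    by (rule pd_eqI pdiffI)+
qed

lemma eventually_line_in_open:
  fixes z b :: "'a::real_normed_vector"
  assumes "open S" "z \<in> S"
  shows "eventually (\<lambda>h. z + h *\<^sub>R b \<in> S) (nhds (0::real))"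
proof -
  have "open ((\<lambda>h::real. z + h *\<^sub>R b) -` S)"
    using assms(1) by (intro open_vimage continuous_intros)
  then show ?thesis
    using assms(2) eventually_nhds[of "\<lambda>h. z + h *\<^sub>R b \<in> S" "0::real"]
    by (intro iffD2[OF eventually_nhds] exI[of _ "(\<lambda>h::real. z + h *\<^sub>R b) -` S"]) auto
qed

text \<open>This makes it legitimate to differentiate a formula known only on an open set, such as
  one valid only inside the cylinder: a short line through \<open>z\<close> stays in the
  set.\<close>

lemma
  assumes "open S" "z \<in> S" and eq: "\<And>y. y \<in> S \<Longrightarrow> f y = g y"
  shows pd_cong: "pd b f z = pd b g z"
    and pdiff_cong: "pdiff b f z \<longleftrightarrow> pdiff b g z"
proof -
  have ev: "eventually (\<lambda>h. f (z + h *\<^sub>R b) = g (z + h *\<^sub>R b)) (nhds 0)"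
    using eventually_line_in_open[OF assms(1,2)] by eventually_elim (rule eq)
  show "pd b f z = pd b g z"
    unfolding pd_def by (rule deriv_cong_ev[OF ev refl])
  show "pdiff b f z \<longleftrightarrow> pdiff b g z"
    unfolding pdiff_def real_differentiable_def
    using DERIV_cong_ev[OF refl ev refl] by blast
qed

text \<open>Mean value arguments need the restriction to a line to be differentiable at every
  parameter, not just at 0; re-centring the line at its point with parameter \<open>t\<close>
  supplies that.\<close>

lemma pdiff_has_derivative_at:
  assumes "pdiff b f (z + t *\<^sub>R b)"
  shows "((\<lambda>h. f (z + h *\<^sub>R b)) has_real_derivative pd b f (z + t *\<^sub>R b)) (at t)"
proof -
  have "((\<lambda>h. f (z + (h + t) *\<^sub>R b)) has_real_derivative pd b f (z + t *\<^sub>R b)) (at 0)"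
    using pdiff_has_derivative[OF assms] by (simp add: algebra_simps scaleR_add_left)
  then show ?thesis
    using DERIV_shift[of "\<lambda>h. f (z + h *\<^sub>R b)" _ 0 t] by simp
qed

section \<open>Total differentiability and the chain rule\<close>

lemma C1_alongD:
  assumes "C1_along dirs S f"
  shows "continuous_on S f"
    and "\<And>b z. b \<in> dirs \<Longrightarrow> z \<in> S \<Longrightarrow> pdiff b f z"
    and "\<And>b. b \<in> dirs \<Longrightarrow> continuous_on S (pd b f)"
  using assms unfolding C1_along_def pdiff_def by auto

text \<open>Continuity upgrades the partial derivatives to a total derivative. The displacement is
  built up one coordinate at a time, and the mean value inequality controls each new coordinate by
  the oscillation of its partial derivative near \<open>x\<close>.\<close>

lemma C1_on_has_derivative:
  fixes f :: "'a::euclidean_space \<Rightarrow> real"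
  assumes S: "open S" and C1: "C1_on S f" and x: "x \<in> S"
  shows "(f has_derivative (\<lambda>v. \<Sum>b\<in>Basis. (v \<bullet> b) * pd b f x)) (at x)"
proof -
  note C = C1_alongD[OF C1[unfolded C1_on_def]]
  \<comment> \<open>The induction runs over the set of coordinates already switched on, for all
    tolerances: an insertion spends half of \<open>e\<close> on the new coordinate and hands the
    other half to the induction hypothesis.\<close>
  have main: "\<exists>\<delta>>0. \<forall>v. norm v < \<delta> \<longrightarrow>
      \<bar>f (x + (\<Sum>b\<in>A. (v \<bullet> b) *\<^sub>R b)) - f x - (\<Sum>b\<in>A. (v \<bullet> b) * pd b f x)\<bar> \<le> e * norm v"
    if "A \<subseteq> Basis" "e > 0" for A e
  proof -
    have "finite A" using that(1) finite_Basis finite_subset by blast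
    then show ?thesis using that
    proof (induction A arbitrary: e rule: finite_induct)
      case empty
      then show ?case by (intro exI[of _ 1]) auto
    next
      case (insert b A)
      then have b: "b \<in> Basis" and e: "e / 2 > 0" and A: "A \<subseteq> Basis" by auto
      from insert.IH[OF A e] obtain d1 where d1: "d1 > 0"
        and IH: "\<And>v. norm v < d1 \<Longrightarrow> \<bar>f (x + (\<Sum>b\<in>A. (v \<bullet> b) *\<^sub>R b)) - f x
            - (\<Sum>b\<in>A. (v \<bullet> b) * pd b f x)\<bar> \<le> e / 2 * norm v" by blast
      have "isCont (pd b f) x"
        using C(3)[OF b] S x continuous_on_eq_continuous_at by blast
      then obtain d2 where d2: "d2 > 0"
        and near: "\<And>y. dist y x < d2 \<Longrightarrow> dist (pd b f y) (pd b f x) < e / 2"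
        using e unfolding continuous_at_eps_delta by blast
      obtain d3 where d3: "d3 > 0" and sub: "ball x d3 \<subseteq> S"
        using S x open_contains_ball by blast
      \<comment> \<open>A sum of at most \<open>n\<close> components, each no longer than
        \<open>norm v\<close>, keeps every intermediate point within \<open>n * norm v\<close> of
        \<open>x\<close>; hence \<open>d2\<close> and \<open>d3\<close> are divided by
        \<open>n\<close>.\<close>
      define n where "n = real (card (insert b A))"
      have n: "n > 0" unfolding n_def using insert.hyps(1) by (simp add: card_gt_0_iff)
      define d where "d = Min {d1, d2 / n, d3 / n}"
      have d: "d > 0" "d \<le> d1" "d \<le> d2 / n" "d \<le> d3 / n"
        unfolding d_def using d1 d2 d3 n by auto
      show ?case
      proof (intro exI conjI allI impI)
        show "d > 0" by fact
        fix v :: 'a assume v: "norm v < d"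
        define y where "y = x + (\<Sum>b\<in>A. (v \<bullet> b) *\<^sub>R b)"
        have dist: "dist (y + t *\<^sub>R b) x < d2 \<and> dist (y + t *\<^sub>R b) x < d3"
          if "\<bar>t\<bar> \<le> \<bar>v \<bullet> b\<bar>" for t
        proof -
          have "dist (y + t *\<^sub>R b) x = norm ((\<Sum>b\<in>A. (v \<bullet> b) *\<^sub>R b) + t *\<^sub>R b)"
            unfolding y_def by (simp add: dist_norm)
          also have "\<dots> \<le> (\<Sum>b\<in>A. norm ((v \<bullet> b) *\<^sub>R b)) + norm (t *\<^sub>R b)"
            by (rule order.trans[OF norm_triangle_ineq add_right_mono[OF norm_sum]])
          also have "\<dots> \<le> (\<Sum>b\<in>A. norm v) + norm v"
          proof (intro add_mono sum_mono)
            show "norm ((v \<bullet> c) *\<^sub>R c) \<le> norm v" if "c \<in> A" for c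
              using A that by (auto simp: Basis_le_norm)
            show "norm (t *\<^sub>R b) \<le> norm v"
              using \<open>\<bar>t\<bar> \<le> \<bar>v \<bullet> b\<bar>\<close> Basis_le_norm[OF b, of v] b by auto
          qed
          also have "\<dots> = n * norm v"
            unfolding n_def using insert.hyps by (simp add: algebra_simps)
          also have "\<dots> < n * d" using v n by simp
          finally show ?thesis using d(3,4) n by (simp add: field_simps)
        qed
        define I where "I = closed_segment 0 (v \<bullet> b)"
        have I: "\<bar>t\<bar> \<le> \<bar>v \<bullet> b\<bar>" if "t \<in> I" for t
          using that unfolding I_def closed_segment_eq_real_ivl by (auto split: if_splits)
        \<comment> \<open>Subtracting the linear part leaves a function whose derivative is the
          oscillation of \<open>pd b f\<close>, at most \<open>e / 2\<close> on the segment.\<close>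
        define g where "g = (\<lambda>h. f (y + h *\<^sub>R b) - h * pd b f x)"
        have "norm (g (v \<bullet> b) - g 0) \<le> e / 2 * norm (v \<bullet> b - 0)"
        proof (rule field_differentiable_bound[where S=I and f'="\<lambda>t. pd b f (y + t *\<^sub>R b) - pd b f x"])
          show "convex I" "v \<bullet> b \<in> I" "0 \<in> I" unfolding I_def by auto
          fix t assume "t \<in> I"
          note t = dist[OF I[OF this]]
          then have "y + t *\<^sub>R b \<in> S" using sub by (auto simp: dist_commute)
          from pdiff_has_derivative_at[OF C(2)[OF b this]]
          show "(g has_field_derivative pd b f (y + t *\<^sub>R b) - pd b f x) (at t within I)"
            unfolding g_def by (auto intro!: derivative_eq_intros intro: DERIV_subset)
          show "norm (pd b f (y + t *\<^sub>R b) - pd b f x) \<le> e / 2"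
            using near[of "y + t *\<^sub>R b"] t by (simp add: dist_norm)
        qed
        also have "\<dots> \<le> e / 2 * norm v"
          using e Basis_le_norm[OF b, of v] by (simp add: mult_left_mono)
        finally have "\<bar>f (y + (v \<bullet> b) *\<^sub>R b) - (v \<bullet> b) * pd b f x - f y\<bar> \<le> e / 2 * norm v"
          unfolding g_def by simp
        moreover have "\<bar>f y - f x - (\<Sum>b\<in>A. (v \<bullet> b) * pd b f x)\<bar> \<le> e / 2 * norm v"
          unfolding y_def using IH v d(2) by force
        moreover have "x + (\<Sum>b\<in>insert b A. (v \<bullet> b) *\<^sub>R b) = y + (v \<bullet> b) *\<^sub>R b"
          unfolding y_def using insert.hyps by (simp add: algebra_simps)
        moreover have "(\<Sum>b\<in>insert b A. (v \<bullet> b) * pd b f x)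
            = (v \<bullet> b) * pd b f x + (\<Sum>b\<in>A. (v \<bullet> b) * pd b f x)"
          using insert.hyps by simp
        ultimately show "\<bar>f (x + (\<Sum>b\<in>insert b A. (v \<bullet> b) *\<^sub>R b)) - f x
            - (\<Sum>b\<in>insert b A. (v \<bullet> b) * pd b f x)\<bar> \<le> e * norm v"
          by (simp only: abs_le_iff) linarith
      qed
    qed
  qed
  show ?thesis
    unfolding has_derivative_at_alt
  proof (intro conjI allI impI)
    show "bounded_linear (\<lambda>v. \<Sum>b\<in>Basis. (v \<bullet> b) * pd b f x)"
      by (intro bounded_linear_sum bounded_linear_mult_left[THEN bounded_linear_compose]
          bounded_linear_inner_left)
    fix e :: real assume "e > 0"
    from main[OF order_refl this] obtain d where d: "d > 0" and
      *: "\<And>v. norm v < d \<Longrightarrow> \<bar>f (x + (\<Sum>b\<in>Basis. (v \<bullet> b) *\<^sub>R b)) - f x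
            - (\<Sum>b\<in>Basis. (v \<bullet> b) * pd b f x)\<bar> \<le> e * norm v" by blast
    show "\<exists>d>0. \<forall>y. norm (y - x) < d \<longrightarrow>
        norm (f y - f x - (\<Sum>b\<in>Basis. ((y - x) \<bullet> b) * pd b f x)) \<le> e * norm (y - x)"
      using d *[of "_ - x"] unfolding euclidean_representation by (intro exI[of _ d]) auto
  qed
qed

text \<open>Total differentiability is asked of the outer function. The inner map enters through its
  restriction to one line, so directional derivatives of its coordinates suffice.\<close>

lemma
  fixes f :: "'a::euclidean_space \<Rightarrow> real" and g :: "'b::real_normed_vector \<Rightarrow> 'a"
  assumes "open S" "C1_on S f" "g z \<in> S"
    and "\<And>c. c \<in> Basis \<Longrightarrow> pdiff b (\<lambda>y. g y \<bullet> c) z"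
  shows pd_chain: "pd b (\<lambda>y. f (g y)) z = (\<Sum>c\<in>Basis. pd b (\<lambda>y. g y \<bullet> c) z * pd c f (g z))"
    and pdiff_chain: "pdiff b (\<lambda>y. f (g y)) z"
proof -
  let ?v = "\<Sum>c\<in>Basis. pd b (\<lambda>y. g y \<bullet> c) z *\<^sub>R c"
  have "((\<lambda>h. \<Sum>c\<in>Basis. (g (z + h *\<^sub>R b) \<bullet> c) *\<^sub>R c) has_vector_derivative ?v) (at 0)"
    by (rule has_vector_derivative_sum, rule has_vector_derivative_scaleR[THEN has_vector_derivative_eq_rhs,
          OF pdiff_has_derivative[OF assms(4)] has_vector_derivative_const]) auto
  then have "((\<lambda>h. g (z + h *\<^sub>R b)) has_vector_derivative ?v) (at 0)"
    by (simp add: euclidean_representation)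
  then have g: "((\<lambda>h. g (z + h *\<^sub>R b)) has_derivative (\<lambda>h. h *\<^sub>R ?v)) (at 0)"
    unfolding has_vector_derivative_def .
  have f: "(f has_derivative (\<lambda>v. \<Sum>c\<in>Basis. (v \<bullet> c) * pd c f (g z))) (at (g (z + 0 *\<^sub>R b)))"
    using C1_on_has_derivative[OF assms(1-3)] by simp
  have der: "((\<lambda>h. f (g (z + h *\<^sub>R b))) has_derivative
      (\<lambda>h. \<Sum>c\<in>Basis. ((h *\<^sub>R ?v) \<bullet> c) * pd c f (g z))) (at 0)"
    using has_derivative_compose[OF g f] by simp
  have comp: "((h *\<^sub>R ?v) \<bullet> c) * pd c f (g z) = (pd b (\<lambda>y. g y \<bullet> c) z * pd c f (g z)) * h"
    if "c \<in> Basis" for c h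
    using that by (simp add: inner_sum_left inner_Basis if_distrib sum.delta' cong: if_cong)
  have "(\<lambda>h. \<Sum>c\<in>Basis. ((h *\<^sub>R ?v) \<bullet> c) * pd c f (g z))
      = (*) (\<Sum>c\<in>Basis. pd b (\<lambda>y. g y \<bullet> c) z * pd c f (g z))"
    by (intro ext) (simp only: comp sum_distrib_right cong: sum.cong)
  with der have "((\<lambda>h. f (g (z + h *\<^sub>R b))) has_real_derivative
      (\<Sum>c\<in>Basis. pd b (\<lambda>y. g y \<bullet> c) z * pd c f (g z))) (at 0)"
    unfolding has_field_derivative_def by (simp only:)
  then show "pd b (\<lambda>y. f (g y)) z = (\<Sum>c\<in>Basis. pd b (\<lambda>y. g y \<bullet> c) z * pd c f (g z))"
    and "pdiff b (\<lambda>y. f (g y)) z"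
    by (rule pd_eqI pdiffI)+
qed


text \<open>The double difference over the parallelogram with sides \<open>h *\<^sub>R a\<close> and
  \<open>h *\<^sub>R b\<close> is symmetric in the two directions. Comparing it with one mixed
  derivative, by a mean value step in each direction, therefore gives both estimates that
  \<open>pd_commute\<close> needs.\<close>

lemma double_difference_bound:
  fixes f :: "'a::real_normed_vector \<Rightarrow> real"
  assumes S: "open S" "z \<in> S"
    and f: "\<And>y. y \<in> S \<Longrightarrow> pdiff a f y" "\<And>y. y \<in> S \<Longrightarrow> pdiff b (pd a f) y"
    and cont: "continuous_on S (pd b (pd a f))" and e: "e > 0"
  shows "\<exists>d>0. \<forall>h. 0 < h \<and> h < d \<longrightarrow>
    \<bar>f (z + h *\<^sub>R a + h *\<^sub>R b) - f (z + h *\<^sub>R a) - f (z + h *\<^sub>R b) + f z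
      - h\<^sup>2 * pd b (pd a f) z\<bar> < e * h\<^sup>2"
proof -
  have "isCont (pd b (pd a f)) z"
    using cont S continuous_on_eq_continuous_at by blast
  then obtain d1 where d1: "d1 > 0"
    and near: "\<And>y. dist y z < d1 \<Longrightarrow> dist (pd b (pd a f) y) (pd b (pd a f) z) < e"
    using e unfolding continuous_at_eps_delta by blast
  obtain d2 where d2: "d2 > 0" and sub: "ball z d2 \<subseteq> S"
    using S open_contains_ball by blast
  \<comment> \<open>The points visited lie within \<open>h * (norm a + norm b)\<close> of
    \<open>z\<close>; the added 1 keeps the divisor positive even for null directions.\<close>
  define n where "n = norm a + norm b + 1"
  have n: "n > 0" unfolding n_def by (simp add: add_nonneg_pos)
  define d where "d = min d1 d2 / n"
  have d: "d > 0" "d * n \<le> d1" "d * n \<le> d2" unfolding d_def using d1 d2 n by auto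
  show ?thesis
  proof (intro exI conjI allI impI)
    show "d > 0" by fact
    fix h assume h: "0 < h \<and> h < d"
    have near': "dist (z + s *\<^sub>R a + t *\<^sub>R b) z < d1 \<and> z + s *\<^sub>R a + t *\<^sub>R b \<in> S"
      if "0 \<le> s" "s \<le> h" "0 \<le> t" "t \<le> h" for s t
    proof -
      have "dist (z + s *\<^sub>R a + t *\<^sub>R b) z = norm (s *\<^sub>R a + t *\<^sub>R b)"
        by (simp add: dist_norm algebra_simps)
      also have "\<dots> \<le> s * norm a + t * norm b"
        using that norm_triangle_ineq[of "s *\<^sub>R a" "t *\<^sub>R b"] by simp
      also have "\<dots> \<le> h * norm a + h * norm b"
        using that by (intro add_mono mult_right_mono) auto
      also have "\<dots> < d * n"
        unfolding n_def using h mult_right_mono[of h d "norm a + norm b"]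
        by (simp add: algebra_simps add_strict_increasing2)
      finally show ?thesis using d sub by (auto simp: dist_commute)
    qed
    \<comment> \<open>The increment in direction \<open>b\<close> as a function of the displacement
      along \<open>a\<close>: the mean value theorem is applied to it first, and then to
      \<open>pd a f\<close> along \<open>b\<close>.\<close>
    define g where "g = (\<lambda>t. f (z + h *\<^sub>R b + t *\<^sub>R a) - f (z + t *\<^sub>R a))"
    have "(g has_real_derivative pd a f (z + h *\<^sub>R b + t *\<^sub>R a) - pd a f (z + t *\<^sub>R a)) (at t)"
      if "0 \<le> t" "t \<le> h" for t
    proof -
      have "z + h *\<^sub>R b + t *\<^sub>R a \<in> S" "z + t *\<^sub>R a \<in> S"
        using near'[of t h] near'[of t 0] that h by (auto simp: algebra_simps)
      from this[THEN f(1), THEN pdiff_has_derivative_at]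
      show ?thesis unfolding g_def by (rule DERIV_diff)
    qed
    then have "\<exists>s>0. s < h \<and> g h - g 0
        = (h - 0) * (pd a f (z + h *\<^sub>R b + s *\<^sub>R a) - pd a f (z + s *\<^sub>R a))"
      using h by (intro MVT2) auto
    then obtain s where s: "0 < s" "s < h"
      and gs: "g h - g 0 = (h - 0) * (pd a f (z + h *\<^sub>R b + s *\<^sub>R a) - pd a f (z + s *\<^sub>R a))"
      by blast
    have "((\<lambda>t. pd a f (z + s *\<^sub>R a + t *\<^sub>R b)) has_real_derivative
        pd b (pd a f) (z + s *\<^sub>R a + t *\<^sub>R b)) (at t)" if "0 \<le> t" "t \<le> h" for t
      using near'[of s t] that s by (intro pdiff_has_derivative_at f(2)) auto
    then have "\<exists>t>0. t < h \<and> pd a f (z + s *\<^sub>R a + h *\<^sub>R b)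
        - pd a f (z + s *\<^sub>R a + 0 *\<^sub>R b)
        = (h - 0) * pd b (pd a f) (z + s *\<^sub>R a + t *\<^sub>R b)"
      using h by (intro MVT2[where f="\<lambda>t. pd a f (z + s *\<^sub>R a + t *\<^sub>R b)"]) auto
    then obtain t where t: "0 < t" "t < h"
      and ks: "pd a f (z + s *\<^sub>R a + h *\<^sub>R b) - pd a f (z + s *\<^sub>R a + 0 *\<^sub>R b)
        = (h - 0) * pd b (pd a f) (z + s *\<^sub>R a + t *\<^sub>R b)"
      by blast
    have "f (z + h *\<^sub>R a + h *\<^sub>R b) - f (z + h *\<^sub>R a) - f (z + h *\<^sub>R b) + f z = g h - g 0"
      unfolding g_def by (simp add: algebra_simps)
    also have "\<dots> = h\<^sup>2 * pd b (pd a f) (z + s *\<^sub>R a + t *\<^sub>R b)"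
      using gs ks by (simp add: algebra_simps power2_eq_square)
    finally have eq: "f (z + h *\<^sub>R a + h *\<^sub>R b) - f (z + h *\<^sub>R a) - f (z + h *\<^sub>R b) + f z
      - h\<^sup>2 * pd b (pd a f) z
      = h\<^sup>2 * (pd b (pd a f) (z + s *\<^sub>R a + t *\<^sub>R b) - pd b (pd a f) z)"
      by (simp add: algebra_simps)
    have "\<bar>pd b (pd a f) (z + s *\<^sub>R a + t *\<^sub>R b) - pd b (pd a f) z\<bar> < e"
      using near near'[of s t] s t by (simp add: dist_real_def)
    then show "\<bar>f (z + h *\<^sub>R a + h *\<^sub>R b) - f (z + h *\<^sub>R a) - f (z + h *\<^sub>R b) + f z
      - h\<^sup>2 * pd b (pd a f) z\<bar> < e * h\<^sup>2"
      unfolding eq using h by (simp add: abs_mult mult.commute[of e])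
  qed
qed

lemma pd_commute:
  fixes f :: "'a::real_normed_vector \<Rightarrow> real"
  assumes S: "open S" "z \<in> S"
    and a: "\<And>y. y \<in> S \<Longrightarrow> pdiff a f y" "\<And>y. y \<in> S \<Longrightarrow> pdiff b (pd a f) y"
      "continuous_on S (pd b (pd a f))"
    and b: "\<And>y. y \<in> S \<Longrightarrow> pdiff b f y" "\<And>y. y \<in> S \<Longrightarrow> pdiff a (pd b f) y"
      "continuous_on S (pd a (pd b f))"
  shows "pd b (pd a f) z = pd a (pd b f) z"
proof (rule ccontr)
  assume ne: "pd b (pd a f) z \<noteq> pd a (pd b f) z"
  \<comment> \<open>Half the gap between the two mixed derivatives: two errors below
    \<open>e * h\<^sup>2\<close> cannot add up to the whole gap times
    \<open>h\<^sup>2\<close>.\<close>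
  define e where "e = \<bar>pd b (pd a f) z - pd a (pd b f) z\<bar> / 2"
  have e: "e > 0" unfolding e_def using ne by simp
  obtain d1 where d1: "d1 > 0" "\<And>h. 0 < h \<Longrightarrow> h < d1 \<Longrightarrow>
    \<bar>f (z + h *\<^sub>R a + h *\<^sub>R b) - f (z + h *\<^sub>R a) - f (z + h *\<^sub>R b) + f z
      - h\<^sup>2 * pd b (pd a f) z\<bar> < e * h\<^sup>2"
    using double_difference_bound[OF S a e] by blast
  obtain d2 where d2: "d2 > 0" "\<And>h. 0 < h \<Longrightarrow> h < d2 \<Longrightarrow>
    \<bar>f (z + h *\<^sub>R b + h *\<^sub>R a) - f (z + h *\<^sub>R b) - f (z + h *\<^sub>R a) + f z
      - h\<^sup>2 * pd a (pd b f) z\<bar> < e * h\<^sup>2"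
    using double_difference_bound[OF S b e] by blast
  define h where "h = min d1 d2 / 2"
  have h: "0 < h" "h < d1" "h < d2" unfolding h_def using d1(1) d2(1) by auto
  have comm: "z + h *\<^sub>R b + h *\<^sub>R a = z + h *\<^sub>R a + h *\<^sub>R b" by (simp add: algebra_simps)
  have "\<bar>h\<^sup>2 * pd b (pd a f) z - h\<^sup>2 * pd a (pd b f) z\<bar> < 2 * (e * h\<^sup>2)"
    using d1(2)[OF h(1,2)] d2(2)[OF h(1,3)] unfolding comm by linarith
  also have "2 * (e * h\<^sup>2) = \<bar>h\<^sup>2 * pd b (pd a f) z - h\<^sup>2 * pd a (pd b f) z\<bar>"
    unfolding e_def by (simp add: abs_mult flip: right_diff_distrib)
  finally show False by simp
qed

section \<open>Regularity of the fields\<close>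

lemma ddx_eq_pd: "ddx i f = pd (space_dir i) f"
  by (rule ext) (simp add: ddx_def)

lemma ddt_eq_pd: "ddt f = pd (0, 1) f"
  by (rule ext) (simp add: ddt_def)

lemma space_dir_Basis: "space_dir i \<in> Basis"
  by (simp add: space_dir_def Basis_prod_def axis_in_Basis_iff)

lemma time_dir_Basis: "(0, 1) \<in> (Basis :: 'n::finite point set)"
  by (simp add: Basis_prod_def)

lemmas pdiff_intros = pdiff_add pdiff_diff pdiff_minus pdiff_mult pdiff_divide pdiff_sum
  pdiff_power2 pdiff_const

lemma open_state_dom: "open state_dom"
  unfolding state_dom_def by (intro open_Times open_greaterThan)

lemma state_domI: "r > 0 \<Longrightarrow> \<theta> > 0 \<Longrightarrow> (r, \<theta>) \<in> state_dom"
  by (simp add: state_dom_def)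

lemma Basis_real_prod: "(Basis :: (real \<times> real) set) = {(1, 0), (0, 1)}"
  by (auto simp: Basis_prod_def)

text \<open>The chain rule for the entropy and for \<open>tau\<close> needs this. At each density
  the energy increases strictly with temperature, so the open strip between the energy curves of two
  temperatures consists of attained values by the intermediate value theorem, and such strips cover
  the domain.\<close>

lemma open_energy_dom:
  assumes "state_equations M"
  shows "open (energy_dom M)"
proof -
  from assms have C: "C1_along Basis state_dom (eps M)"
    and pos: "\<And>r \<theta>. r > 0 \<Longrightarrow> \<theta> > 0 \<Longrightarrow> pd (0, 1) (eps M) (r, \<theta>) > 0"
    unfolding state_equations_def C2_on_def C1_on_def by auto
  have der: "((\<lambda>t. eps M (r, t)) has_real_derivative pd (0, 1) (eps M) (r, t)) (at t)"
    if "r > 0" "t > 0" for r t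
    using pdiff_has_derivative_at[of "(0, 1)" "eps M" "(r, 0)" t] C1_alongD(2)[OF C, of "(0, 1)" "(r, t)"] that
    by (simp add: state_domI Basis_real_prod)
  have mono: "eps M (r, t1) < eps M (r, t2)" if "r > 0" "0 < t1" "t1 < t2" for r t1 t2
    by (rule DERIV_pos_imp_increasing[OF \<open>t1 < t2\<close>]) (use der pos that in \<open>meson order_less_le_trans\<close>)
  \<comment> \<open>\<open>U (t1, t2)\<close> is the strip of pairs (density, energy) strictly
    between the energy curves of the temperatures \<open>t1\<close> and \<open>t2\<close>.\<close>
  define U where "U = (\<lambda>(t1, t2). ({0<..} \<times> UNIV) \<inter>
    (\<lambda>x. (snd x - eps M (fst x, t1), eps M (fst x, t2) - snd x)) -` ({0<..} \<times> {0<..}))"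
  have "open (U (t1, t2))" if "0 < t1" "t1 < t2" for t1 t2
    unfolding U_def prod.case using that
    by (intro continuous_open_preimage open_Times open_greaterThan open_UNIV continuous_intros
        continuous_on_compose2[OF C1_alongD(1)[OF C]])
       (auto simp: state_dom_def)
  then have "open (\<Union>t\<in>{(t1, t2). 0 < t1 \<and> t1 < t2}. U t)" by auto
  also have "(\<Union>t\<in>{(t1, t2). 0 < t1 \<and> t1 < t2}. U t) = energy_dom M"
  proof (intro equalityI subsetI)
    fix x assume "x \<in> (\<Union>t\<in>{(t1, t2). 0 < t1 \<and> t1 < t2}. U t)"
    then obtain t1 t2 r e where t: "0 < t1" "t1 < t2" and x: "x = (r, e)" and r: "r > 0"
      and e: "eps M (r, t1) < e" "e < eps M (r, t2)"
      unfolding U_def by (cases x) auto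
    have "\<exists>t\<ge>t1. t \<le> t2 \<and> eps M (r, t) = e"
      using t e r by (intro IVT') (auto intro!: DERIV_continuous_on DERIV_subset[OF der])
    then obtain t where "t > 0" "eps M (r, t) = e" using t(1) by (metis order_less_le_trans)
    then show "x \<in> energy_dom M"
      unfolding energy_dom_def x using r by (intro image_eqI[of _ _ "(r, t)"]) (auto intro: state_domI)
  next
    fix x assume "x \<in> energy_dom M"
    then obtain r t where x: "x = (r, eps M (r, t))" and "r > 0" "t > 0"
      unfolding energy_dom_def state_dom_def by auto
    \<comment> \<open>Any two positive temperatures that bracket \<open>t\<close> would do.\<close>
    then have "x \<in> U (t / 2, 2 * t)"
      unfolding U_def using mono[of r "t / 2" t] mono[of r t "2 * t"] by simp
    then show "x \<in> (\<Union>t\<in>{(t1, t2). 0 < t1 \<and> t1 < t2}. U t)"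
      using \<open>t > 0\<close> by (intro UN_I[of "(t / 2, 2 * t)"]) auto
  qed
  finally show ?thesis .
qed

lemma open_tau_dom:
  assumes "state_equations M"
  shows "open (tau_dom M)"
proof -
  have "tau_dom M = (\<lambda>x. (fst x, fst (snd x))) -` energy_dom M"
    unfolding tau_dom_def by auto
  also have "open \<dots>"
    by (intro open_vimage open_energy_dom assms continuous_intros)
  finally show ?thesis .
qed

section \<open>Positivity and differentiability along a solution\<close>

locale mgd_flow =
  fixes M :: "'n::finite mgd" and \<Omega> :: "(real^'n) set" and T :: real
    and s :: "real \<times> real \<Rightarrow> real"
  assumes open_\<Omega>: "open \<Omega>"
    and state_eqs: "state_equations M" and coeffs: "coefficients M" and srcs: "sources \<Omega> T M"
    and sol: "mgd_solution \<Omega> T M" and ent: "is_entropy M s"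
begin

abbreviation S where "S \<equiv> cylinder \<Omega> T"
abbreviation e where "e \<equiv> (space_dir :: 'n \<Rightarrow> 'n point)"

lemma open_S: "open S"
  unfolding cylinder_def using open_\<Omega> by (intro open_Times open_greaterThanLessThan)

lemma C1_fields:
  "C1_along Basis S (rho M)" "C1_along Basis S (temp M)"
  "C1_along Basis S (\<lambda>y. vel M y $ j)" "C1_along Basis S (\<lambda>y. mag M y $ j)"
  using sol unfolding mgd_solution_def C2_space_C1_time_def C1_on_def by auto

lemma C1_derivs:
  "C1_along (range e) S (pd (e i) (rho M))" "C1_along (range e) S (pd (e i) (temp M))"
  "C1_along (range e) S (pd (e i) (\<lambda>y. vel M y $ j))"
  "C1_along (range e) S (pd (e i) (\<lambda>y. mag M y $ j))"
  using sol unfolding mgd_solution_def C2_space_C1_time_def ddx_eq_pd by auto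

lemma C1_sources:
  "C1_along (range e) S (\<lambda>y. force M y $ j)" "C1_along (range e) S (heat M)"
  using srcs unfolding sources_def by auto

lemma pos:
  assumes "z \<in> S"
  shows "rho M z > 0" "temp M z > 0" "eps_theta_f M z > 0" "pres_rho_f M z \<ge> 0" "tau_f M z > 0"
    "heat M z \<ge> 0" "kap_f M z \<ge> 0" "mu_f M z \<ge> 0" "lam_f M z \<ge> 0"
proof -
  show *: "rho M z > 0" "temp M z > 0" using sol assms unfolding mgd_solution_def by auto
  show "eps_theta_f M z > 0" "pres_rho_f M z \<ge> 0"
    using state_eqs * unfolding state_equations_def eps_theta_f_def pres_rho_f_def state_f_def by auto
  have "(rho M z, eps_f M z, vel M z, mag M z) \<in> tau_dom M"
    using * unfolding tau_dom_def energy_dom_def eps_f_def state_f_def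
    by (auto intro!: image_eqI[of _ _ "(rho M z, temp M z)"] state_domI)
  then show "tau_f M z > 0" using coeffs unfolding coefficients_def tau_f_def by auto
  show "heat M z \<ge> 0" using srcs assms unfolding sources_def by auto
  show "kap_f M z \<ge> 0" "mu_f M z \<ge> 0" "lam_f M z \<ge> 0"
    using coeffs * state_domI[of "rho M z" "temp M z"]
    unfolding coefficients_def kap_f_def mu_f_def lam_f_def state_f_def by auto
qed

lemma pdiff_fields:
  assumes "z \<in> S" "b \<in> Basis"
  shows "pdiff b (rho M) z" "pdiff b (temp M) z"
    "pdiff b (\<lambda>y. vel M y $ j) z" "pdiff b (\<lambda>y. mag M y $ j) z"
  using C1_fields[THEN C1_alongD(2)] assms by auto

lemma pdiff_derivs:
  assumes "z \<in> S"
  shows "pdiff (e k) (pd (e i) (rho M)) z" "pdiff (e k) (pd (e i) (temp M)) z"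
    "pdiff (e k) (pd (e i) (\<lambda>y. vel M y $ j)) z" "pdiff (e k) (pd (e i) (\<lambda>y. mag M y $ j)) z"
  using C1_derivs[THEN C1_alongD(2)] assms by auto

lemma pdiff_sources:
  assumes "z \<in> S"
  shows "pdiff (e k) (\<lambda>y. force M y $ j) z" "pdiff (e k) (heat M) z"
  using C1_sources[THEN C1_alongD(2)] assms by auto

lemma
  assumes F: "C1_on state_dom F" and z: "z \<in> S" "b \<in> Basis"
  shows pd_state: "pd b (\<lambda>y. F (state_f M y)) z
      = pd b (rho M) z * pd (1, 0) F (state_f M z) + pd b (temp M) z * pd (0, 1) F (state_f M z)"
    and pdiff_state: "pdiff b (\<lambda>y. F (state_f M y)) z"
proof -
  have 1: "state_f M z \<in> state_dom" unfolding state_f_def using pos z by (intro state_domI)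
  have 2: "pdiff b (\<lambda>y. state_f M y \<bullet> c) z" if "c \<in> Basis" for c
    using that pdiff_fields[OF z] by (auto simp: Basis_real_prod state_f_def inner_Pair)
  show "pdiff b (\<lambda>y. F (state_f M y)) z"
    by (rule pdiff_chain[OF open_state_dom F 1 2])
  show "pd b (\<lambda>y. F (state_f M y)) z
      = pd b (rho M) z * pd (1, 0) F (state_f M z) + pd b (temp M) z * pd (0, 1) F (state_f M z)"
    using pd_chain[OF open_state_dom F 1 2] by (simp add: Basis_real_prod state_f_def inner_Pair)
qed

lemma C1_state_functions:
  "C1_on state_dom (pres M)" "C1_on state_dom (eps M)" "C1_on state_dom (kap M)"
  "C1_on state_dom (mu M)" "C1_on state_dom (lam M)"
  "C1_on state_dom (pd (1, 0) (pres M))" "C1_on state_dom (pd (0, 1) (pres M))"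
  "C1_on state_dom (pd (0, 1) (eps M))"
  using state_eqs coeffs unfolding state_equations_def coefficients_def C2_on_def
  by (auto simp: Basis_real_prod)

lemma pdiff_state_functions:
  assumes "z \<in> S" "b \<in> Basis"
  shows "pdiff b (pres_f M) z" "pdiff b (eps_f M) z" "pdiff b (kap_f M) z" "pdiff b (mu_f M) z"
    "pdiff b (lam_f M) z" "pdiff b (pres_rho_f M) z" "pdiff b (pres_theta_f M) z"
    "pdiff b (eps_theta_f M) z"
  using C1_state_functions[THEN pdiff_state, OF assms]
  unfolding pres_f_def[abs_def] eps_f_def[abs_def] kap_f_def[abs_def] mu_f_def[abs_def]
    lam_f_def[abs_def] pres_rho_f_def[abs_def] pres_theta_f_def[abs_def] eps_theta_f_def[abs_def] .

lemma pd_pres_f: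
  assumes "z \<in> S" "b \<in> Basis"
  shows "pd b (pres_f M) z = pd b (rho M) z * pres_rho_f M z + pd b (temp M) z * pres_theta_f M z"
  using pd_state[OF C1_state_functions(1) assms]
  unfolding pres_f_def[abs_def] pres_rho_f_def pres_theta_f_def .

text \<open>The Maxwell relation eliminates \<open>\<epsilon>\<^sub>\<rho>\<close>.\<close>

lemma pd_eps_f:
  assumes "z \<in> S" "b \<in> Basis"
  shows "pd b (eps_f M) z = pd b (rho M) z * (pres_f M z - temp M z * pres_theta_f M z) / (rho M z)\<^sup>2
    + pd b (temp M) z * eps_theta_f M z"
proof -
  have "pres_f M z = temp M z * pres_theta_f M z + (rho M z)\<^sup>2 * pd (1, 0) (eps M) (state_f M z)"
    using state_eqs pos(1,2)[OF assms(1)]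
    unfolding state_equations_def pres_f_def pres_theta_f_def state_f_def by blast
  then show ?thesis
    using pd_state[OF C1_state_functions(2) assms] pos(1)[OF assms(1)]
    unfolding eps_f_def[abs_def] eps_theta_f_def by simp
qed

lemma pdiff_vel_inner:
  assumes "z \<in> S" "b \<in> Basis" "c \<in> Basis"
  shows "pdiff b (\<lambda>y. vel M y \<bullet> c) z" "pdiff b (\<lambda>y. mag M y \<bullet> c) z"
proof -
  obtain i where "c = axis i 1" using assms(3) by (auto simp: Basis_vec_def)
  then show "pdiff b (\<lambda>y. vel M y \<bullet> c) z" "pdiff b (\<lambda>y. mag M y \<bullet> c) z"
    using pdiff_fields[OF assms(1,2)] by (auto simp: inner_axis)
qed

lemma pdiff_tau:
  assumes z: "z \<in> S" "b \<in> Basis"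
  shows "pdiff b (tau_f M) z"
proof -
  have 0: "open (tau_dom M)" using state_eqs by (rule open_tau_dom)
  have 1: "C1_on (tau_dom M) (tau M)" using coeffs unfolding coefficients_def by blast
  have 2: "(rho M z, eps_f M z, vel M z, mag M z) \<in> tau_dom M"
    unfolding tau_dom_def energy_dom_def eps_f_def state_f_def using pos(1,2)[OF z(1)]
    by (auto intro!: image_eqI[of _ _ "(rho M z, temp M z)"] state_domI)
  have 3: "pdiff b (\<lambda>y. (rho M y, eps_f M y, vel M y, mag M y) \<bullet> c) z" if "c \<in> Basis" for c
    using that pdiff_fields[OF z] pdiff_state_functions[OF z] pdiff_vel_inner[OF z]
    by (auto simp: Basis_prod_def)
  show ?thesis
    unfolding tau_f_def[abs_def] by (rule pdiff_chain[OF 0 1 2 3])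
qed

text \<open>This is the Gibbs relation theta ds = d(eps) - (p / rho^2) d(rho) read along the flow.
  Keeping the direction general serves the time derivative and the spatial gradient at once.\<close>

lemma
  assumes z: "z \<in> S" "b \<in> Basis"
  shows pd_entropy: "pd b (entropy_f M s) z
      = (pd b (eps_f M) z - pres_f M z / (rho M z)\<^sup>2 * pd b (rho M) z) / temp M z"
    and pdiff_entropy: "pdiff b (entropy_f M s) z"
proof -
  note p = pos(1,2)[OF z(1)]
  have 0: "open (energy_dom M)" using state_eqs by (rule open_energy_dom)
  have 1: "C1_on (energy_dom M) s" using ent unfolding is_entropy_def by blast
  have 2: "(rho M z, eps_f M z) \<in> energy_dom M"
    unfolding energy_dom_def eps_f_def state_f_def using p
    by (auto intro!: image_eqI[of _ _ "(rho M z, temp M z)"] state_domI)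
  have 3: "pdiff b (\<lambda>y. (rho M y, eps_f M y) \<bullet> c) z" if "c \<in> Basis" for c
    using that pdiff_fields[OF z] pdiff_state_functions[OF z] by (auto simp: Basis_real_prod)
  show "pdiff b (entropy_f M s) z"
    unfolding entropy_f_def[abs_def] by (rule pdiff_chain[OF 0 1 2 3])
  have "pd (1, 0) s (rho M z, eps_f M z) = - (pres_f M z / ((rho M z)\<^sup>2 * temp M z))"
    "pd (0, 1) s (rho M z, eps_f M z) = 1 / temp M z"
    using ent p unfolding is_entropy_def eps_f_def pres_f_def state_f_def by blast+
  then have "pd b (entropy_f M s) z
      = pd b (rho M) z * (- (pres_f M z / ((rho M z)\<^sup>2 * temp M z))) + pd b (eps_f M) z * (1 / temp M z)"
    using pd_chain[OF 0 1 2 3] unfolding entropy_f_def[abs_def] by (simp add: Basis_real_prod)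
  then show "pd b (entropy_f M s) z
      = (pd b (eps_f M) z - pres_f M z / (rho M z)\<^sup>2 * pd b (rho M) z) / temp M z"
    using p by (simp add: field_simps)
qed

end

section \<open>The regularizing velocities and fluxes\<close>

lemma pdiff_eq_on:
  assumes "open S" "z \<in> S" "\<And>y. y \<in> S \<Longrightarrow> f y = g y" "pdiff b g z"
  shows "pdiff b f z"
  using pdiff_cong[of S z f g b, OF assms(1-3)] assms(4) by simp

context mgd_flow begin

abbreviation du where "du i j z \<equiv> pd (e i) (\<lambda>y. vel M y $ j) z"
abbreviation dB where "dB i j z \<equiv> pd (e i) (\<lambda>y. mag M y $ j) z"

lemmas pdiff_space_fields = pdiff_fields[OF _ space_dir_Basis] pdiff_derivs pdiff_sources
  pdiff_state_functions[OF _ space_dir_Basis] pdiff_tau[OF _ space_dir_Basis]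
  pdiff_entropy[OF _ space_dir_Basis]

lemma tot_pres_eq: "tot_pres_f M = (\<lambda>y. pres_f M y + 1/2 * (\<Sum>k\<in>UNIV. mag M y $ k * mag M y $ k))"
  by (rule ext) (simp add: tot_pres_f_def power2_norm_eq_inner inner_vec_def)

lemma pd_sum_squares:
  assumes "\<And>k. pdiff b (\<lambda>y. v y $ k) z"
  shows "pd b (\<lambda>y. 1/2 * (\<Sum>k\<in>UNIV. v y $ k * v y $ k)) z = (\<Sum>k\<in>UNIV. v z $ k * pd b (\<lambda>y. v y $ k) z)"
    and "pdiff b (\<lambda>y. 1/2 * (\<Sum>k\<in>UNIV. v y $ k * v y $ k)) z"
proof -
  have d: "pdiff b (\<lambda>y. \<Sum>k\<in>UNIV. v y $ k * v y $ k) z"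
    by (intro pdiff_intros assms)
  show "pdiff b (\<lambda>y. 1/2 * (\<Sum>k\<in>UNIV. v y $ k * v y $ k)) z"
    by (intro pdiff_intros assms)
  show "pd b (\<lambda>y. 1/2 * (\<Sum>k\<in>UNIV. v y $ k * v y $ k)) z = (\<Sum>k\<in>UNIV. v z $ k * pd b (\<lambda>y. v y $ k) z)"
    unfolding pd_mult[OF pdiff_const d]
    by (simp add: pd_sum pdiff_mult pd_mult assms sum_distrib_left)
qed

lemma pd_tot_pres:
  assumes "z \<in> S" "b \<in> Basis"
  shows "pd b (tot_pres_f M) z = pd b (pres_f M) z + (\<Sum>k\<in>UNIV. mag M z $ k * pd b (\<lambda>y. mag M y $ k) z)"
  unfolding tot_pres_eq
  using pd_sum_squares[of b "mag M" z, OF pdiff_fields(4)[OF assms]]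
  by (subst pd_add) (use pdiff_state_functions[OF assms] in auto)

text \<open>The terms with div B stay in: summand \<open>i\<close> is then exactly the derivative
  along \<open>e i\<close> of the antisymmetric tensor with entries u_i B_j - B_i u_j, the form from
  which \<open>dvg_beta\<close> starts.\<close>

lemma beta_nth:
  assumes "z \<in> S"
  shows "beta M z $ j = (\<Sum>i\<in>UNIV. du i i z * mag M z $ j + vel M z $ i * dB i j z
    - (dB i i z * vel M z $ j + mag M z $ i * du i j z))"
  unfolding beta_def dvg_tensor_def outer_def ddx_eq_pd
  using assms by (simp add: pd_diff pd_mult pdiff_mult pdiff_space_fields)

lemma dvg_tensor_mag:
  assumes "z \<in> S"
  shows "dvg_tensor (\<lambda>y. outer (mag M y) (mag M y)) z $ j
    = (\<Sum>i\<in>UNIV. dB i i z * mag M z $ j + mag M z $ i * dB i j z)"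
  unfolding dvg_tensor_def outer_def ddx_eq_pd
  using assms by (simp add: pd_mult pdiff_space_fields)

lemma w_hat_nth:
  assumes "z \<in> S"
  shows "w_hat M z $ j = tau_f M z / rho M z * (rho M z * (\<Sum>i\<in>UNIV. vel M z $ i * du i j z)
    - (\<Sum>i\<in>UNIV. dB i i z * mag M z $ j + mag M z $ i * dB i j z)
    + pd (e j) (tot_pres_f M) z - rho M z * force M z $ j)"
  unfolding w_hat_def
  using dvg_tensor_mag[OF assms] by (simp add: advect_def grad_vec_def grad_def ddx_eq_pd)

lemma dvg_rho_vel:
  assumes "z \<in> S"
  shows "dvg (\<lambda>y. rho M y *\<^sub>R vel M y) z
    = (\<Sum>i\<in>UNIV. pd (e i) (rho M) z * vel M z $ i + rho M z * du i i z)"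
  unfolding dvg_def ddx_eq_pd using assms by (simp add: pd_mult pdiff_space_fields)

text \<open>By the product rule div(rho u (x) u) is div(rho u) u + rho (u.grad) u, and the second
  summand is the one already present in \<open>w_hat\<close>.\<close>

lemma w_reg_nth:
  assumes "z \<in> S"
  shows "w_reg M z $ j = w_hat M z $ j
    + tau_f M z / rho M z * dvg (\<lambda>y. rho M y *\<^sub>R vel M y) z * vel M z $ j"
proof -
  have "dvg_tensor (\<lambda>y. rho M y *\<^sub>R outer (vel M y) (vel M y) - outer (mag M y) (mag M y)) z $ j
    = (\<Sum>i\<in>UNIV. pd (e i) (rho M) z * vel M z $ i * vel M z $ j
        + rho M z * (du i i z * vel M z $ j + vel M z $ i * du i j z)
        - (dB i i z * mag M z $ j + mag M z $ i * dB i j z))"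
    unfolding dvg_tensor_def outer_def ddx_eq_pd
    using assms by (simp add: pd_diff pd_mult pdiff_mult pdiff_space_fields algebra_simps)
  also have "\<dots> = dvg (\<lambda>y. rho M y *\<^sub>R vel M y) z * vel M z $ j
      + rho M z * (\<Sum>i\<in>UNIV. vel M z $ i * du i j z)
      - (\<Sum>i\<in>UNIV. dB i i z * mag M z $ j + mag M z $ i * dB i j z)"
    unfolding dvg_rho_vel[OF assms]
    by (simp add: sum_distrib_left sum_distrib_right sum.distrib sum_subtractf algebra_simps)
  finally have DT: "dvg_tensor (\<lambda>y. rho M y *\<^sub>R outer (vel M y) (vel M y) - outer (mag M y) (mag M y)) z $ j
    = \<dots>" .
  have "w_reg M z $ j = tau_f M z / rho M z *
    (dvg_tensor (\<lambda>y. rho M y *\<^sub>R outer (vel M y) (vel M y) - outer (mag M y) (mag M y)) z $ j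
      + pd (e j) (tot_pres_f M) z - rho M z * force M z $ j)"
    by (simp add: w_reg_def grad_def ddx_eq_pd)
  then show ?thesis
    unfolding w_hat_nth[OF assms] DT by (simp only: algebra_simps)
qed

text \<open>By the chain rule these gradients are built from state functions, their first
  derivatives and gradients of the unknowns, all of which can be differentiated once more in
  space.\<close>

lemma pdiff_pd_state:
  assumes z: "z \<in> S"
  shows "pdiff (e k) (pd (e i) (pres_f M)) z" "pdiff (e k) (pd (e i) (eps_f M)) z"
proof -
  show "pdiff (e k) (pd (e i) (pres_f M)) z"
    by (rule pdiff_eq_on[OF open_S z], erule pd_pres_f[OF _ space_dir_Basis])
       (intro pdiff_intros pdiff_space_fields z)
  show "pdiff (e k) (pd (e i) (eps_f M)) z"
    by (rule pdiff_eq_on[OF open_S z], erule pd_eps_f[OF _ space_dir_Basis])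
       (intro pdiff_intros pdiff_space_fields z, use pos(1)[OF z] in simp)
qed

lemma pdiff_pd_tot_pres:
  assumes z: "z \<in> S"
  shows "pdiff (e k) (pd (e i) (tot_pres_f M)) z"
  by (rule pdiff_eq_on[OF open_S z], erule pd_tot_pres[OF _ space_dir_Basis])
     (intro pdiff_intros pdiff_space_fields pdiff_pd_state z)

lemma pdiff_beta:
  assumes z: "z \<in> S"
  shows "pdiff (e k) (\<lambda>y. beta M y $ j) z"
  by (rule pdiff_eq_on[OF open_S z], erule beta_nth)
     (intro pdiff_intros pdiff_space_fields z)

lemma pdiff_w_hat:
  assumes z: "z \<in> S"
  shows "pdiff (e k) (\<lambda>y. w_hat M y $ j) z"
  by (rule pdiff_eq_on[OF open_S z], erule w_hat_nth)
     (intro pdiff_intros pdiff_space_fields pdiff_pd_tot_pres z, use pos(1)[OF z] in simp)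

lemma pdiff_w_reg:
  assumes z: "z \<in> S"
  shows "pdiff (e k) (\<lambda>y. w_reg M y $ j) z"
proof (rule pdiff_eq_on[OF open_S z])
  show "w_reg M y $ j = w_hat M y $ j + tau_f M y / rho M y *
      (\<Sum>i\<in>UNIV. pd (e i) (rho M) y * vel M y $ i + rho M y * du i i y) * vel M y $ j" if "y \<in> S" for y
    unfolding w_reg_nth[OF that] dvg_rho_vel[OF that] ..
qed (intro pdiff_intros pdiff_space_fields pdiff_w_hat z, use pos(1)[OF z] in simp)

lemma q_flux_nth:
  assumes "z \<in> S"
  shows "q_flux M z $ j = - (kap_f M z * pd (e j) (temp M) z + tau_f M z *
    (rho M z * ((\<Sum>k\<in>UNIV. vel M z $ k * pd (e k) (eps_f M) z)
      - pres_f M z / (rho M z)\<^sup>2 * (\<Sum>k\<in>UNIV. vel M z $ k * pd (e k) (rho M) z)) - heat M z)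
    * vel M z $ j)"
  by (simp add: q_flux_def grad_def inner_vec_def ddx_eq_pd)

lemma pdiff_q_flux:
  assumes z: "z \<in> S"
  shows "pdiff (e k) (\<lambda>y. q_flux M y $ j) z"
  by (rule pdiff_eq_on[OF open_S z], erule q_flux_nth)
     (intro pdiff_intros pdiff_space_fields pdiff_pd_state z, use pos(1)[OF z] in simp)

lemma Pi_tensor_nth:
  "Pi_tensor M z $ i $ j =
     Pi_NS M z $ i $ j + rho M z * (vel M z $ i * w_hat M z $ j)
     - tau_f M z * (beta M z $ i * mag M z $ j + mag M z $ i * beta M z $ j)
     + tau_f M z * ((\<Sum>k\<in>UNIV. vel M z $ k * pd (e k) (pres_f M) z)
          + rho M z * Cs2_f M z * (\<Sum>k\<in>UNIV. du k k z)
          + (\<Sum>k\<in>UNIV. beta M z $ k * mag M z $ k)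
          - pres_theta_f M z / (rho M z * eps_theta_f M z) * heat M z) * (mat 1 :: real^'n^'n) $ i $ j"
  by (simp add: Pi_tensor_def outer_def grad_def dvg_def inner_vec_def ddx_eq_pd)

lemma Pi_NS_nth:
  "Pi_NS M z $ i $ j = mu_f M z * ((du i j z + du j i z)
      - (2/3 * (\<Sum>k\<in>UNIV. du k k z)) * (mat 1 :: real^'n^'n) $ i $ j)
     + (lam_f M z * (\<Sum>k\<in>UNIV. du k k z)) * (mat 1 :: real^'n^'n) $ i $ j"
  by (simp add: Pi_NS_def strain_def grad_vec_def dvg_def transpose_def ddx_eq_pd)

lemma pdiff_Pi:
  assumes z: "z \<in> S"
  shows "pdiff (e k) (\<lambda>y. Pi_tensor M y $ i $ j) z"
  unfolding Pi_tensor_nth Pi_NS_nth Cs2_f_def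
  by (intro pdiff_intros pdiff_space_fields pdiff_pd_state pdiff_beta pdiff_w_hat z;
      use pos[OF z] in simp)

lemma pd_commute_space:
  assumes "C1_along (range e) S f" "\<And>i. C1_along (range e) S (pd (e i) f)" and z: "z \<in> S"
  shows "pd (e j) (pd (e i) f) z = pd (e i) (pd (e j) f) z"
  by (rule pd_commute[OF open_S z])
     (auto intro: C1_alongD(2,3)[OF assms(1)] C1_alongD(2,3)[OF assms(2)])

text \<open>\<open>\<beta>\<close> is the divergence of an antisymmetric tensor, so its divergence vanishes by symmetry of
  second derivatives.\<close>

lemma dvg_beta:
  assumes z: "z \<in> S"
  shows "(\<Sum>j\<in>UNIV. pd (e j) (\<lambda>y. beta M y $ j) z) = 0"
proof -
  define G where "G = (\<lambda>i j y. vel M y $ i * mag M y $ j - mag M y $ i * vel M y $ j)"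
  \<comment> \<open>\<open>dG k i j\<close> is the derivative along \<open>e k\<close> of the tensor
    \<open>G i j\<close>, written out by the product rule so that its own derivatives expose the
    second derivatives of u and B.\<close>
  define dG where "dG = (\<lambda>k i j y. du k i y * mag M y $ j + vel M y $ i * dB k j y
    - (dB k i y * vel M y $ j + mag M y $ i * du k j y))"
  have pG: "pd (e k) (dG l i j) z = pd (e l) (dG k i j) z" for k l i j
  proof -
    have C: "C1_along (range e) S (\<lambda>y. vel M y $ a)" "C1_along (range e) S (\<lambda>y. mag M y $ a)" for a
      using C1_fields(3,4)[of a] space_dir_Basis unfolding C1_along_def by auto
    note cu = pd_commute_space[OF C(1) C1_derivs(3) z, of k l]
      pd_commute_space[OF C(2) C1_derivs(4) z, of k l]
    show ?thesis
      unfolding dG_def using z cu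
      by (simp add: pd_diff pd_add pd_mult pdiff_mult pdiff_add pdiff_diff pdiff_space_fields)
  qed
  have anti: "dG k j i y = - dG k i j y" for k i j y
    unfolding dG_def by (simp add: algebra_simps)
  have pd: "pdiff (e l) (dG k i j) z" for k l i j
    unfolding dG_def by (intro pdiff_intros pdiff_space_fields z)
  have "pd (e j) (\<lambda>y. beta M y $ j) z = (\<Sum>i\<in>UNIV. pd (e j) (dG i i j) z)" for j
  proof -
    have "pd (e j) (\<lambda>y. beta M y $ j) z = pd (e j) (\<lambda>y. \<Sum>i\<in>UNIV. dG i i j y) z"
      by (rule pd_cong[OF open_S z]) (simp add: beta_nth dG_def)
    then show ?thesis using pd_sum[OF pd] by simp
  qed
  then have sum_eq: "(\<Sum>j\<in>UNIV. pd (e j) (\<lambda>y. beta M y $ j) z) = (\<Sum>j\<in>UNIV. \<Sum>i\<in>UNIV. pd (e j) (dG i i j) z)"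
    by simp
  \<comment> \<open>Exchanging the two derivatives, then the tensor indices at the cost of a sign,
    then renaming, turns the sum into its own negative.\<close>
  also have "\<dots> = (\<Sum>j\<in>UNIV. \<Sum>i\<in>UNIV. pd (e i) (dG j i j) z)"
    by (intro sum.cong refl pG)
  also have "\<dots> = (\<Sum>j\<in>UNIV. \<Sum>i\<in>UNIV. - pd (e i) (dG j j i) z)"
  proof (intro sum.cong refl)
    fix j i
    have "dG j i j = (\<lambda>y. - dG j j i y)" by (rule ext) (rule anti)
    then show "pd (e i) (dG j i j) z = - pd (e i) (dG j j i) z"
      using pd_minus[OF pd[of i j j i]] by simp
  qed
  also have "\<dots> = - (\<Sum>i\<in>UNIV. \<Sum>j\<in>UNIV. pd (e i) (dG j j i) z)"
    by (subst sum.swap) (simp add: sum_negf)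
  also have "\<dots> = - (\<Sum>j\<in>UNIV. pd (e j) (\<lambda>y. beta M y $ j) z)"
    unfolding sum_eq ..
  finally show ?thesis by linarith
qed

section \<open>The balance equations in nonconservative form\<close>

abbreviation dw where "dw i j z \<equiv> pd (e i) (\<lambda>y. w_reg M y $ j) z"
abbreviation div_rho_u where
  "div_rho_u z \<equiv> (\<Sum>i\<in>UNIV. pd (e i) (rho M) z * vel M z $ i + rho M z * du i i z)"

lemmas pdiff_time_fields = pdiff_fields[OF _ time_dir_Basis]
  pdiff_state_functions(1,2)[OF _ time_dir_Basis] pdiff_entropy[OF _ time_dir_Basis]

lemma div_mag:
  assumes "z \<in> S"
  shows "(\<Sum>i\<in>UNIV. dB i i z) = 0"
  using sol assms unfolding mgd_solution_def dvg_def ddx_eq_pd by auto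

lemma mass_expanded:
  assumes z: "z \<in> S"
  shows "pd (0, 1) (rho M) z + (\<Sum>i\<in>UNIV. (vel M z $ i - w_reg M z $ i) * pd (e i) (rho M) z)
    + rho M z * (\<Sum>i\<in>UNIV. du i i z - dw i i z) = 0"
proof -
  have "pd (0, 1) (rho M) z + (\<Sum>i\<in>UNIV. pd (e i) (\<lambda>y. rho M y * (vel M y $ i - w_reg M y $ i)) z) = 0"
    using sol z unfolding mgd_solution_def mass_eq_def dvg_def ddx_eq_pd ddt_eq_pd by auto
  then show ?thesis
    using z by (simp add: pd_mult pd_diff pdiff_diff pdiff_space_fields pdiff_w_reg sum.distrib
        sum_distrib_left mult.commute)
qed

text \<open>The inertial terms in which u_j is not differentiated collect into u_j times the mass
  equation and drop out; div B = 0 leaves only the tension (B.grad) B_j of the magnetic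
  tensor.\<close>

lemma momentum_expanded:
  assumes z: "z \<in> S"
  shows "rho M z * (pd (0, 1) (\<lambda>y. vel M y $ j) z
      + (\<Sum>i\<in>UNIV. (vel M z $ i - w_reg M z $ i) * du i j z))
    - (\<Sum>i\<in>UNIV. mag M z $ i * dB i j z) + pd (e j) (tot_pres_f M) z
    = (\<Sum>i\<in>UNIV. pd (e i) (\<lambda>y. Pi_tensor M y $ i $ j) z)
      + (rho M z - tau_f M z * div_rho_u z) * force M z $ j"
proof -
  have "momentum_eq M z" using sol z unfolding mgd_solution_def by blast
  then have "pd (0, 1) (\<lambda>y. rho M y * vel M y $ j) z
    + (\<Sum>i\<in>UNIV. pd (e i) (\<lambda>y. rho M y * (vel M y $ i - w_reg M y $ i) * vel M y $ j
        - mag M y $ i * mag M y $ j) z)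
    + pd (e j) (tot_pres_f M) z
    = (\<Sum>i\<in>UNIV. pd (e i) (\<lambda>y. Pi_tensor M y $ i $ j) z)
      + (rho M z - tau_f M z * div_rho_u z) * force M z $ j"
    unfolding momentum_eq_def dvg_rho_vel[OF z] vec_eq_iff
    by (auto simp: ddt_vec_def dvg_tensor_def outer_def grad_def ddx_eq_pd ddt_eq_pd dest: spec[of _ j])
  moreover have "pd (0, 1) (\<lambda>y. rho M y * vel M y $ j) z
      = pd (0, 1) (rho M) z * vel M z $ j + rho M z * pd (0, 1) (\<lambda>y. vel M y $ j) z"
    using z by (simp add: pd_mult pdiff_time_fields)
  moreover have "(\<Sum>i\<in>UNIV. pd (e i) (\<lambda>y. rho M y * (vel M y $ i - w_reg M y $ i) * vel M y $ j
        - mag M y $ i * mag M y $ j) z)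
    = (\<Sum>i\<in>UNIV. (vel M z $ i - w_reg M z $ i) * pd (e i) (rho M) z) * vel M z $ j
    + rho M z * (\<Sum>i\<in>UNIV. du i i z - dw i i z) * vel M z $ j
    + rho M z * (\<Sum>i\<in>UNIV. (vel M z $ i - w_reg M z $ i) * du i j z)
    - (\<Sum>i\<in>UNIV. dB i i z) * mag M z $ j - (\<Sum>i\<in>UNIV. mag M z $ i * dB i j z)"
  proof -
    have t: "pd (e i) (\<lambda>y. rho M y * (vel M y $ i - w_reg M y $ i) * vel M y $ j
        - mag M y $ i * mag M y $ j) z
      = (pd (e i) (rho M) z * (vel M z $ i - w_reg M z $ i) + rho M z * (du i i z - dw i i z))
          * vel M z $ j + rho M z * (vel M z $ i - w_reg M z $ i) * du i j z
        - (dB i i z * mag M z $ j + mag M z $ i * dB i j z)" for i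
      using pdiff_space_fields[OF z] pdiff_w_reg[OF z]
      by (simp only: pd_mult pd_diff pdiff_diff pdiff_mult)
    show ?thesis
      unfolding t by (simp add: sum.distrib sum_subtractf sum_distrib_left sum_distrib_right algebra_simps)
  qed
  moreover have "(pd (0, 1) (rho M) z + (\<Sum>i\<in>UNIV. (vel M z $ i - w_reg M z $ i) * pd (e i) (rho M) z)
    + rho M z * (\<Sum>i\<in>UNIV. du i i z - dw i i z)) * vel M z $ j = 0"
    using mass_expanded[OF z] by simp
  ultimately show ?thesis
    using div_mag[OF z] by (simp add: algebra_simps)
qed

text \<open>The energy flux \<open>|B|\<^sup>2 v - (v \<bullet> B) B\<close> with \<open>v = u - w_hat\<close> is \<open>ind_flux\<close> applied to \<open>B\<close>.\<close>

definition ind_flux where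
  "ind_flux i j y = (vel M y $ i - w_hat M y $ i) * mag M y $ j - mag M y $ i * (vel M y $ j - w_hat M y $ j)"

text \<open>One half of the antisymmetric tensor in the induction equation. Applied to B it is the
  energy flux tau (beta.B) u, so the energy and induction equations share it; the transposed half is
  what survives their subtraction.\<close>

definition relax_flux where
  "relax_flux i j y = tau_f M y * (vel M y $ i * beta M y $ j)"

lemma pdiff_fluxes:
  assumes z: "z \<in> S"
  shows "pdiff (e k) (\<lambda>y. ind_flux i j y) z" "pdiff (e k) (\<lambda>y. relax_flux i j y) z"
  unfolding ind_flux_def relax_flux_def
  by (intro pdiff_intros pdiff_space_fields pdiff_w_hat pdiff_beta z)+

lemma induction_expanded:
  assumes z: "z \<in> S"
  shows "pd (0, 1) (\<lambda>y. mag M y $ j) z + (\<Sum>i\<in>UNIV. pd (e i) (\<lambda>y. ind_flux i j y) z)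
    = (\<Sum>i\<in>UNIV. pd (e i) (\<lambda>y. relax_flux i j y) z) - (\<Sum>i\<in>UNIV. pd (e i) (\<lambda>y. relax_flux j i y) z)"
proof -
  have "induction_eq M z" using sol z unfolding mgd_solution_def by blast
  then have eq: "pd (0, 1) (\<lambda>y. mag M y $ j) z + (\<Sum>i\<in>UNIV. pd (e i) (\<lambda>y. ind_flux i j y) z)
    = (\<Sum>i\<in>UNIV. pd (e i) (\<lambda>y. tau_f M y *
        (vel M y $ i * beta M y $ j - beta M y $ i * vel M y $ j)) z)"
    unfolding induction_eq_def vec_eq_iff ind_flux_def
    by (auto simp: ddt_vec_def dvg_tensor_def outer_def ddx_eq_pd ddt_eq_pd dest: spec[of _ j])
  have L: "(\<lambda>y. tau_f M y * (vel M y $ i * beta M y $ j - beta M y $ i * vel M y $ j))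
      = (\<lambda>y. relax_flux i j y - relax_flux j i y)" for i
    by (rule ext) (simp add: relax_flux_def algebra_simps)
  show ?thesis
    using pdiff_fluxes[OF z] unfolding eq L by (simp add: pd_diff sum_subtractf)
qed

text \<open>Each flux of the form tensor times B or u splits in two: the divergence of the tensor
  contracted with the vector, which the induction or momentum equation will remove, and the tensor
  contracted with the gradient of the vector, which remains to be evaluated.\<close>

lemma energy_expanded:
  assumes z: "z \<in> S"
  shows "rho M z * ((\<Sum>j\<in>UNIV. vel M z $ j * pd (0, 1) (\<lambda>y. vel M y $ j) z)
      + (\<Sum>i\<in>UNIV. \<Sum>j\<in>UNIV. (vel M z $ i - w_reg M z $ i) * (vel M z $ j * du i j z))
      + pd (0, 1) (eps_f M) z + (\<Sum>i\<in>UNIV. (vel M z $ i - w_reg M z $ i) * pd (e i) (eps_f M) z))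
    + (\<Sum>i\<in>UNIV. (vel M z $ i - w_reg M z $ i) * pd (e i) (pres_f M) z)
    + pres_f M z * (\<Sum>i\<in>UNIV. du i i z - dw i i z)
    + (\<Sum>j\<in>UNIV. mag M z $ j * pd (0, 1) (\<lambda>y. mag M y $ j) z)
    + (\<Sum>i\<in>UNIV. \<Sum>j\<in>UNIV. pd (e i) (\<lambda>y. ind_flux i j y) z * mag M z $ j)
    + (\<Sum>i\<in>UNIV. \<Sum>j\<in>UNIV. ind_flux i j z * dB i j z)
    = dvg (\<lambda>y. - q_flux M y) z
    + (\<Sum>i\<in>UNIV. \<Sum>j\<in>UNIV. pd (e i) (\<lambda>y. relax_flux i j y) z * mag M z $ j)
    + (\<Sum>i\<in>UNIV. \<Sum>j\<in>UNIV. relax_flux i j z * dB i j z)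
    + (\<Sum>i\<in>UNIV. \<Sum>j\<in>UNIV. pd (e i) (\<lambda>y. Pi_tensor M y $ i $ j) z * vel M z $ j)
    + (\<Sum>i\<in>UNIV. \<Sum>j\<in>UNIV. Pi_tensor M z $ i $ j * du i j z)
    + rho M z * (\<Sum>i\<in>UNIV. (vel M z $ i - w_reg M z $ i) * force M z $ i) + heat M z"
proof -
  define ke where "ke = (\<lambda>y. 1/2 * (\<Sum>k\<in>UNIV. vel M y $ k * vel M y $ k))"
  define me where "me = (\<lambda>y. 1/2 * (\<Sum>k\<in>UNIV. mag M y $ k * mag M y $ k))"
  define c where "c = (\<lambda>i y. vel M y $ i - w_reg M y $ i)"
  have ke: "pd b ke z = (\<Sum>k\<in>UNIV. vel M z $ k * pd b (\<lambda>y. vel M y $ k) z)" "pdiff b ke z"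
    and me: "pd b me z = (\<Sum>k\<in>UNIV. mag M z $ k * pd b (\<lambda>y. mag M y $ k) z)" "pdiff b me z"
    if "b \<in> Basis" for b
    unfolding ke_def me_def using pd_sum_squares pdiff_fields[OF z that] by blast+
  note ke_s = ke[OF space_dir_Basis] and ke_t = ke[OF time_dir_Basis]
    and me_t = me[OF time_dir_Basis]
  have c: "pdiff (e k) (c i) z" "pd (e k) (c i) z = du k i z - dw k i z" for k i
    unfolding c_def using z by (simp_all add: pd_diff pdiff_diff pdiff_space_fields pdiff_w_reg)
  have E: "energy_f M = (\<lambda>y. rho M y * ke y + rho M y * eps_f M y)"
    by (rule ext) (simp add: energy_f_def ke_def power2_norm_eq_inner inner_vec_def)
  have me_eq: "(norm (mag M y))\<^sup>2 = 2 * me y" for y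
    by (simp add: me_def power2_norm_eq_inner inner_vec_def)
  have "energy_eq M z" using sol z unfolding mgd_solution_def by blast
  then have eq: "pd (0, 1) (\<lambda>y. energy_f M y + me y) z
      + (\<Sum>i\<in>UNIV. pd (e i) (\<lambda>y. (energy_f M y + pres_f M y) * c i y
          + (\<Sum>j\<in>UNIV. ind_flux i j y * mag M y $ j)) z)
      = (\<Sum>i\<in>UNIV. pd (e i) (\<lambda>y. - q_flux M y $ i + ((\<Sum>j\<in>UNIV. relax_flux i j y * mag M y $ j)
          + (\<Sum>j\<in>UNIV. Pi_tensor M y $ i $ j * vel M y $ j))) z)
      + rho M z * (\<Sum>i\<in>UNIV. c i z * force M z $ i) + heat M z"
  proof -
    have 1: "((energy_f M y + pres_f M y) *\<^sub>R (vel M y - w_reg M y)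
                + (norm (mag M y))\<^sup>2 *\<^sub>R (vel M y - w_hat M y)
                - ((vel M y - w_hat M y) \<bullet> mag M y) *\<^sub>R mag M y) $ i
      = (energy_f M y + pres_f M y) * c i y + (\<Sum>j\<in>UNIV. ind_flux i j y * mag M y $ j)" for y i
      unfolding c_def ind_flux_def power2_norm_eq_inner inner_vec_def
      by (simp add: sum_distrib_left sum_distrib_right sum_subtractf sum.distrib algebra_simps)
    have 2: "(- q_flux M y + (tau_f M y * (beta M y \<bullet> mag M y)) *\<^sub>R vel M y
                + Pi_tensor M y *v vel M y) $ i
      = - q_flux M y $ i + ((\<Sum>j\<in>UNIV. relax_flux i j y * mag M y $ j)
          + (\<Sum>j\<in>UNIV. Pi_tensor M y $ i $ j * vel M y $ j))" for y i
      unfolding relax_flux_def inner_vec_def matrix_vector_mult_def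
      by (simp add: sum_distrib_left sum_distrib_right algebra_simps)
    have 3: "(vel M z - w_reg M z) \<bullet> force M z = (\<Sum>i\<in>UNIV. c i z * force M z $ i)"
      unfolding c_def inner_vec_def by simp
    show ?thesis
      using \<open>energy_eq M z\<close> unfolding energy_eq_def dvg_def ddx_eq_pd ddt_eq_pd 1 2 3
      unfolding me_eq by simp
  qed
  have dE: "pd b (energy_f M) z = pd b (rho M) z * (ke z + eps_f M z)
      + rho M z * (pd b ke z + pd b (eps_f M) z)" "pdiff b (energy_f M) z" if "b \<in> Basis" for b
    unfolding E using ke[OF that] pdiff_fields[OF z that] pdiff_state_functions[OF z that]
    by (simp_all add: pd_add pd_mult pdiff_add pdiff_mult algebra_simps)
  have Ez: "energy_f M z = rho M z * ke z + rho M z * eps_f M z" unfolding E ..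
  note dE_s = dE[OF space_dir_Basis] and dE_t = dE[OF time_dir_Basis]
  have "pd (0, 1) (\<lambda>y. energy_f M y + me y) z
    = pd (0, 1) (rho M) z * (ke z + eps_f M z) + rho M z * (pd (0, 1) ke z + pd (0, 1) (eps_f M) z)
      + pd (0, 1) me z"
    using dE_t me_t by (simp add: pd_add)
  moreover have "(\<Sum>i\<in>UNIV. pd (e i) (\<lambda>y. (energy_f M y + pres_f M y) * c i y
          + (\<Sum>j\<in>UNIV. ind_flux i j y * mag M y $ j)) z)
    = (\<Sum>i\<in>UNIV. c i z * pd (e i) (rho M) z) * (ke z + eps_f M z)
    + rho M z * (\<Sum>i\<in>UNIV. c i z * pd (e i) ke z)
    + rho M z * (\<Sum>i\<in>UNIV. c i z * pd (e i) (eps_f M) z)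
    + (\<Sum>i\<in>UNIV. c i z * pd (e i) (pres_f M) z)
    + rho M z * (\<Sum>i\<in>UNIV. du i i z - dw i i z) * (ke z + eps_f M z)
    + pres_f M z * (\<Sum>i\<in>UNIV. du i i z - dw i i z)
    + (\<Sum>i\<in>UNIV. \<Sum>j\<in>UNIV. pd (e i) (\<lambda>y. ind_flux i j y) z * mag M z $ j)
    + (\<Sum>i\<in>UNIV. \<Sum>j\<in>UNIV. ind_flux i j z * dB i j z)"
  proof -
    have "pd (e i) (\<lambda>y. (energy_f M y + pres_f M y) * c i y + (\<Sum>j\<in>UNIV. ind_flux i j y * mag M y $ j)) z
      = c i z * pd (e i) (rho M) z * (ke z + eps_f M z)
        + rho M z * (c i z * pd (e i) ke z) + rho M z * (c i z * pd (e i) (eps_f M) z)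
        + c i z * pd (e i) (pres_f M) z
        + rho M z * (du i i z - dw i i z) * (ke z + eps_f M z)
        + pres_f M z * (du i i z - dw i i z)
        + (\<Sum>j\<in>UNIV. pd (e i) (\<lambda>y. ind_flux i j y) z * mag M z $ j)
        + (\<Sum>j\<in>UNIV. ind_flux i j z * dB i j z)" for i
    proof -
      have "pd (e i) (\<lambda>y. (energy_f M y + pres_f M y) * c i y + (\<Sum>j\<in>UNIV. ind_flux i j y * mag M y $ j)) z
        = (pd (e i) (energy_f M) z + pd (e i) (pres_f M) z) * c i z
        + (energy_f M z + pres_f M z) * (du i i z - dw i i z)
        + (\<Sum>j\<in>UNIV. pd (e i) (\<lambda>y. ind_flux i j y) z * mag M z $ j + ind_flux i j z * dB i j z)"
        using dE_s(2) c pdiff_space_fields[OF z] pdiff_fluxes[OF z]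
        by (simp only: pd_add pd_mult pd_sum pdiff_add pdiff_mult pdiff_sum)
      then show ?thesis
        unfolding dE_s(1) sum.distrib Ez by (simp add: algebra_simps)
    qed
    then show ?thesis
      by (simp only: sum.distrib flip: sum_distrib_left sum_distrib_right)
  qed
  moreover have "(\<Sum>i\<in>UNIV. pd (e i) (\<lambda>y. - q_flux M y $ i + ((\<Sum>j\<in>UNIV. relax_flux i j y * mag M y $ j)
          + (\<Sum>j\<in>UNIV. Pi_tensor M y $ i $ j * vel M y $ j))) z)
    = dvg (\<lambda>y. - q_flux M y) z
    + (\<Sum>i\<in>UNIV. \<Sum>j\<in>UNIV. pd (e i) (\<lambda>y. relax_flux i j y) z * mag M z $ j)
    + (\<Sum>i\<in>UNIV. \<Sum>j\<in>UNIV. relax_flux i j z * dB i j z)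
    + (\<Sum>i\<in>UNIV. \<Sum>j\<in>UNIV. pd (e i) (\<lambda>y. Pi_tensor M y $ i $ j) z * vel M z $ j)
    + (\<Sum>i\<in>UNIV. \<Sum>j\<in>UNIV. Pi_tensor M z $ i $ j * du i j z)"
  proof -
    have "pd (e i) (\<lambda>y. - q_flux M y $ i + ((\<Sum>j\<in>UNIV. relax_flux i j y * mag M y $ j)
          + (\<Sum>j\<in>UNIV. Pi_tensor M y $ i $ j * vel M y $ j))) z
      = pd (e i) (\<lambda>y. - q_flux M y $ i) z
        + ((\<Sum>j\<in>UNIV. pd (e i) (\<lambda>y. relax_flux i j y) z * mag M z $ j + relax_flux i j z * dB i j z)
        + (\<Sum>j\<in>UNIV. pd (e i) (\<lambda>y. Pi_tensor M y $ i $ j) z * vel M z $ j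
            + Pi_tensor M z $ i $ j * du i j z))" for i
      using pdiff_space_fields[OF z] pdiff_fluxes[OF z] pdiff_Pi[OF z] pdiff_q_flux[OF z]
      by (simp only: pd_add pd_mult pd_sum pdiff_add pdiff_mult pdiff_sum pdiff_minus)
    then show ?thesis
      unfolding dvg_def ddx_eq_pd
      by (simp add: sum.distrib)
  qed
  \<comment> \<open>The mass equation times the specific energy absorbs every term in which that
    energy is not differentiated.\<close>
  moreover have "(pd (0, 1) (rho M) z + (\<Sum>i\<in>UNIV. c i z * pd (e i) (rho M) z)
      + rho M z * (\<Sum>i\<in>UNIV. du i i z - dw i i z)) * (ke z + eps_f M z) = 0"
    using mass_expanded[OF z] unfolding c_def by simp
  moreover have "(\<Sum>i\<in>UNIV. c i z * pd (e i) ke z)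
      = (\<Sum>i\<in>UNIV. \<Sum>j\<in>UNIV. c i z * (vel M z $ j * du i j z))"
    unfolding ke_s(1) by (simp add: sum_distrib_left)
  ultimately show ?thesis
    using eq unfolding ke_t(1) me_t(1) c_def by (simp only: algebra_simps)
qed

end

section \<open>Internal energy balance\<close>

text \<open>Energy equation minus \<open>u \<bullet>\<close> (momentum equation) minus \<open>B \<bullet>\<close> (induction equation).\<close>

lemma balance_core:
  fixes u :: "'a::real_inner"
  assumes r: "r > 0" and ta: "ta > 0"
    and mom: "r *\<^sub>R (ut + a) - BB + DP = PI + (r - ta * DR) *\<^sub>R F"
    and ind: "Bt + DK = DA - DA'"
    and en: "r * (u \<bullet> ut + u \<bullet> a + et + De) + c \<bullet> dp + p * dv + Bt \<bullet> B + DK \<bullet> B + XK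
      = dq + DA \<bullet> B + XA + PI \<bullet> u + XP + r * (c \<bullet> F) + Q"
    and XK: "XK = (u - wh) \<bullet> (DP - dp) - (u - wh) \<bullet> BB"
    and c: "c = u - (wh + (ta / r * DR) *\<^sub>R u)"
    and wh: "wh = (ta / r) *\<^sub>R (r *\<^sub>R adv - BB + DP - r *\<^sub>R F)"
  shows "r * (et + De) + p * dv = dq + Q + XP + XA + DA' \<bullet> B + ta / r * DR * (u \<bullet> dp)
    + r / ta * (wh \<bullet> wh) - r * (wh \<bullet> adv)"
proof -
  \<comment> \<open>\<open>c\<close> is \<open>(1 - k) *\<^sub>R u - wh\<close>, and the force in
    \<open>mom\<close> carries the factor \<open>r * (1 - k)\<close>; so of the work of
    \<open>F\<close> only \<open>- r * (wh \<bullet> F)\<close> survives.\<close>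
  define k where "k = ta / r * DR"
  have k: "ta * DR = r * k" unfolding k_def using r by simp
  have 1: "u \<bullet> (r *\<^sub>R (ut + a) - BB + DP) = u \<bullet> (PI + (r - r * k) *\<^sub>R F)"
    using mom unfolding k by simp
  have 2: "(Bt + DK) \<bullet> B = (DA - DA') \<bullet> B" unfolding ind ..
  \<comment> \<open>After the subtraction, total pressure, tension and force are left paired with
    \<open>wh\<close>. Contracting the definition of \<open>wh\<close> with \<open>wh\<close> itself
    trades them for its square and the term with \<open>adv\<close>.\<close>
  have "wh \<bullet> wh = ta / r * (wh \<bullet> (r *\<^sub>R adv - BB + DP - r *\<^sub>R F))"
    by (subst (2) wh) simp
  then have 3: "r / ta * (wh \<bullet> wh) = wh \<bullet> (r *\<^sub>R adv - BB + DP - r *\<^sub>R F)"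
    using r ta by simp
  show ?thesis
    unfolding 3 using 1 2 en unfolding XK c k_def[symmetric]
    by (simp add: inner_simps algebra_simps inner_commute)
qed

lemma sum_swap_distrib:
  fixes f :: "'a \<Rightarrow> 'b \<Rightarrow> real"
  shows "(\<Sum>i\<in>I. \<Sum>j\<in>J. f i j * g j) = (\<Sum>j\<in>J. (\<Sum>i\<in>I. f i j) * g j)"
  by (subst sum.swap) (simp add: sum_distrib_right)

lemma sum_mat_1:
  fixes f :: "'n::finite \<Rightarrow> 'n \<Rightarrow> real"
  shows "(\<Sum>i\<in>UNIV. \<Sum>j\<in>UNIV. (mat 1 :: real^'n^'n) $ i $ j * f i j) = (\<Sum>i\<in>UNIV. f i i)"
  by (simp add: mat_def if_distrib[of "\<lambda>x. x * _"] sum.delta cong: if_cong)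

text \<open>Here \<open>rr\<close>, \<open>a\<close>, \<open>g\<close>, \<open>ed\<close> are the
  derivatives along u of density, temperature, pressure and energy, and \<open>d\<close> is div u.
  With the Maxwell relation built into \<open>ed\<close>, the products \<open>rr * a\<close> cancel
  between pressure work and heat flux. The \<open>pth\<close> part of \<open>C\<close> is the term
  in \<open>d\<^sup>2\<close> that the second square requires.\<close>

lemma entropy_production_identity:
  fixes r th ta pr pth eth Q d a rr p :: real
  assumes "r > 0" "th > 0" "eth > 0"
    and g: "g = rr * pr + a * pth"
    and ed: "ed = rr * (p - th * pth) / r\<^sup>2 + a * eth"
    and C: "C = pr + th * pth\<^sup>2 / (r\<^sup>2 * eth)"
  shows "ta * (g + r * C * d - pth / (r * eth) * Q) * d + ta / r * (rr + r * d) * g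
      + ta * (r * (ed - p / r\<^sup>2 * rr) - Q) * a / th + Q
    = ta * pr / r * (rr + r * d)\<^sup>2
      + ta * r * eth / th * (th * pth / (r * eth) * d + a - Q / (2 * r * eth))\<^sup>2
      + Q * (1 - ta * Q / (4 * r * th * eth))"
  using assms(1-3) unfolding g ed C
  by (simp add: divide_simps) (simp add: algebra_simps power2_eq_square)

context mgd_flow begin

text \<open>Components are packed into vectors so that \<open>balance_core\<close> can work with
  inner products. The last summand will be cancelled by the power of the part rho u (x) w_hat of the
  stress.\<close>

lemma heat_balance:
  assumes z: "z \<in> S"
  shows "rho M z * (pd (0, 1) (eps_f M) z
      + (\<Sum>i\<in>UNIV. (vel M z $ i - w_reg M z $ i) * pd (e i) (eps_f M) z))
    + pres_f M z * (\<Sum>i\<in>UNIV. du i i z - dw i i z)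
    = dvg (\<lambda>y. - q_flux M y) z + heat M z
    + (\<Sum>i\<in>UNIV. \<Sum>j\<in>UNIV. Pi_tensor M z $ i $ j * du i j z)
    + (\<Sum>i\<in>UNIV. \<Sum>j\<in>UNIV. relax_flux i j z * dB i j z)
    + (\<Sum>j\<in>UNIV. (\<Sum>i\<in>UNIV. pd (e i) (\<lambda>y. relax_flux j i y) z) * mag M z $ j)
    + tau_f M z / rho M z * div_rho_u z * (vel M z \<bullet> grad (pres_f M) z)
    + rho M z / tau_f M z * (norm (w_hat M z))\<^sup>2
    - rho M z * (w_hat M z \<bullet> advect (vel M) (vel M z) z)"
proof -
  define ut where "ut = (\<chi> j. pd (0, 1) (\<lambda>y. vel M y $ j) z)"
  define Bt where "Bt = (\<chi> j. pd (0, 1) (\<lambda>y. mag M y $ j) z)"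
  define a where "a = (\<chi> j. \<Sum>i\<in>UNIV. (vel M z $ i - w_reg M z $ i) * du i j z)"
  define BB where "BB = (\<chi> j. \<Sum>i\<in>UNIV. mag M z $ i * dB i j z)"
  define PI where "PI = (\<chi> j. \<Sum>i\<in>UNIV. pd (e i) (\<lambda>y. Pi_tensor M y $ i $ j) z)"
  define DK where "DK = (\<chi> j. \<Sum>i\<in>UNIV. pd (e i) (\<lambda>y. ind_flux i j y) z)"
  define DA where "DA = (\<chi> j. \<Sum>i\<in>UNIV. pd (e i) (\<lambda>y. relax_flux i j y) z)"
  define DA' where "DA' = (\<chi> j. \<Sum>i\<in>UNIV. pd (e i) (\<lambda>y. relax_flux j i y) z)"
  note defs = ut_def Bt_def a_def BB_def PI_def DK_def DA_def DA'_def
  have "rho M z * (pd (0, 1) (eps_f M) z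
      + (\<Sum>i\<in>UNIV. (vel M z $ i - w_reg M z $ i) * pd (e i) (eps_f M) z))
    + pres_f M z * (\<Sum>i\<in>UNIV. du i i z - dw i i z)
    = dvg (\<lambda>y. - q_flux M y) z + heat M z
    + (\<Sum>i\<in>UNIV. \<Sum>j\<in>UNIV. Pi_tensor M z $ i $ j * du i j z)
    + (\<Sum>i\<in>UNIV. \<Sum>j\<in>UNIV. relax_flux i j z * dB i j z)
    + DA' \<bullet> mag M z
    + tau_f M z / rho M z * div_rho_u z * (vel M z \<bullet> grad (pres_f M) z)
    + rho M z / tau_f M z * (w_hat M z \<bullet> w_hat M z)
    - rho M z * (w_hat M z \<bullet> advect (vel M) (vel M z) z)"
  proof (rule balance_core[where ut=ut and Bt=Bt and a=a and BB=BB and PI=PI and DK=DK and DA=DA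
        and F="force M z" and c="vel M z - w_reg M z" and DP="grad (tot_pres_f M) z"
        and XK="\<Sum>i\<in>UNIV. \<Sum>j\<in>UNIV. ind_flux i j z * dB i j z"])
    show "rho M z > 0" "tau_f M z > 0" using pos[OF z] by auto
    show "rho M z *\<^sub>R (ut + a) - BB + grad (tot_pres_f M) z
        = PI + (rho M z - tau_f M z * div_rho_u z) *\<^sub>R force M z"
      unfolding vec_eq_iff defs using momentum_expanded[OF z] by (simp add: grad_def ddx_eq_pd)
    show "Bt + DK = DA - DA'"
      unfolding vec_eq_iff defs using induction_expanded[OF z] by simp
    have adv: "(\<Sum>i\<in>UNIV. \<Sum>j\<in>UNIV. (vel M z $ i - w_reg M z $ i) * (vel M z $ j * du i j z))
        = (\<Sum>j\<in>UNIV. vel M z $ j * (\<Sum>i\<in>UNIV. (vel M z $ i - w_reg M z $ i) * du i j z))"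
      by (subst sum.swap) (simp add: sum_distrib_left mult.left_commute)
    show "rho M z * (vel M z \<bullet> ut + vel M z \<bullet> a + pd (0, 1) (eps_f M) z
          + (\<Sum>i\<in>UNIV. (vel M z $ i - w_reg M z $ i) * pd (e i) (eps_f M) z))
        + (vel M z - w_reg M z) \<bullet> grad (pres_f M) z + pres_f M z * (\<Sum>i\<in>UNIV. du i i z - dw i i z)
        + Bt \<bullet> mag M z + DK \<bullet> mag M z + (\<Sum>i\<in>UNIV. \<Sum>j\<in>UNIV. ind_flux i j z * dB i j z)
      = dvg (\<lambda>y. - q_flux M y) z + DA \<bullet> mag M z + (\<Sum>i\<in>UNIV. \<Sum>j\<in>UNIV. relax_flux i j z * dB i j z)
        + PI \<bullet> vel M z + (\<Sum>i\<in>UNIV. \<Sum>j\<in>UNIV. Pi_tensor M z $ i $ j * du i j z)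
        + rho M z * ((vel M z - w_reg M z) \<bullet> force M z) + heat M z"
      using energy_expanded[OF z] unfolding adv sum_swap_distrib[where g="\<lambda>j. mag M z $ j"]
        sum_swap_distrib[where g="\<lambda>j. vel M z $ j"] defs inner_vec_def
      by (simp add: grad_def ddx_eq_pd mult.commute)
    \<comment> \<open>The gradient of the magnetic pressure. Contracting \<open>ind_flux\<close>
      with grad B pairs u - w_hat with this vector minus the tension \<open>BB\<close>.\<close>
    have DPdp: "grad (tot_pres_f M) z - grad (pres_f M) z
        = (\<chi> i. \<Sum>k\<in>UNIV. mag M z $ k * dB i k z)"
      unfolding vec_eq_iff by (simp add: grad_def ddx_eq_pd pd_tot_pres[OF z space_dir_Basis])
    show "(\<Sum>i\<in>UNIV. \<Sum>j\<in>UNIV. ind_flux i j z * dB i j z)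
      = (vel M z - w_hat M z) \<bullet> (grad (tot_pres_f M) z - grad (pres_f M) z) - (vel M z - w_hat M z) \<bullet> BB"
    proof -
      have "(\<Sum>i\<in>UNIV. \<Sum>j\<in>UNIV. ind_flux i j z * dB i j z)
        = (\<Sum>i\<in>UNIV. \<Sum>j\<in>UNIV. (vel M z $ i - w_hat M z $ i) * (mag M z $ j * dB i j z))
        - (\<Sum>i\<in>UNIV. \<Sum>j\<in>UNIV. (mag M z $ i * dB i j z) * (vel M z $ j - w_hat M z $ j))"
        unfolding ind_flux_def by (simp add: algebra_simps flip: sum_subtractf)
      then show ?thesis
        unfolding sum_swap_distrib DPdp BB_def inner_vec_def
        by (simp add: sum_distrib_left mult.commute)
    qed
    show "vel M z - w_reg M z
        = vel M z - (w_hat M z + (tau_f M z / rho M z * div_rho_u z) *\<^sub>R vel M z)"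
      unfolding vec_eq_iff using w_reg_nth[OF z] dvg_rho_vel[OF z] by simp
    \<comment> \<open>Since div B = 0, the divergence of B (x) B in \<open>w_hat_def\<close> is the
      tension \<open>BB\<close>.\<close>
    show "w_hat M z = (tau_f M z / rho M z) *\<^sub>R (rho M z *\<^sub>R advect (vel M) (vel M z) z - BB
        + grad (tot_pres_f M) z - rho M z *\<^sub>R force M z)"
      unfolding w_hat_def BB_def
      using dvg_tensor_mag[OF z] div_mag[OF z]
      by (simp add: vec_eq_iff sum.distrib flip: sum_distrib_right)
  qed
  then show ?thesis
    unfolding DA'_def inner_vec_def power2_norm_eq_inner by simp
qed

section \<open>Power of the stress and of the magnetic fluxes\<close>

lemma div_u: "dvg (vel M) z = (\<Sum>k\<in>UNIV. du k k z)"
  by (simp add: dvg_def ddx_eq_pd)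

text \<open>Because div beta = 0, the transposed flux gives the term with grad tau plus tau
  \<open>s2\<close>, and the stress gives -tau (\<open>s2\<close> + \<open>s3\<close>), so
  \<open>s2\<close> cancels. What remains beside tau, div u (beta.B) + \<open>s1\<close> -
  \<open>s3\<close>, is beta.beta by the formula for beta with div B = 0.\<close>

lemma magnetic_dissipation:
  assumes z: "z \<in> S"
  shows "(\<Sum>i\<in>UNIV. \<Sum>j\<in>UNIV. relax_flux i j z * dB i j z)
    + (\<Sum>j\<in>UNIV. (\<Sum>i\<in>UNIV. pd (e i) (\<lambda>y. relax_flux j i y) z) * mag M z $ j)
    - tau_f M z * (\<Sum>i\<in>UNIV. \<Sum>j\<in>UNIV. (beta M z $ i * mag M z $ j + mag M z $ i * beta M z $ j) * du i j z)
    + tau_f M z * (beta M z \<bullet> mag M z) * dvg (vel M) z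
    = tau_f M z * (norm (beta M z))\<^sup>2 + (mag M z \<bullet> vel M z) * (beta M z \<bullet> grad (tau_f M) z)"
proof -
  define s1 where "s1 = (\<Sum>i\<in>UNIV. \<Sum>j\<in>UNIV. vel M z $ i * beta M z $ j * dB i j z)"
  define s2 where "s2 = (\<Sum>i\<in>UNIV. \<Sum>j\<in>UNIV. beta M z $ i * mag M z $ j * du i j z)"
  define s3 where "s3 = (\<Sum>i\<in>UNIV. \<Sum>j\<in>UNIV. mag M z $ i * beta M z $ j * du i j z)"
  have 1: "(\<Sum>i\<in>UNIV. \<Sum>j\<in>UNIV. relax_flux i j z * dB i j z) = tau_f M z * s1"
    unfolding relax_flux_def s1_def by (simp add: sum_distrib_left mult.assoc)
  have 3: "(\<Sum>i\<in>UNIV. \<Sum>j\<in>UNIV. (beta M z $ i * mag M z $ j + mag M z $ i * beta M z $ j) * du i j z) = s2 + s3"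
    unfolding s2_def s3_def by (simp add: sum.distrib distrib_right)
  have A': "pd (e i) (\<lambda>y. relax_flux j i y) z = (beta M z $ i * pd (e i) (tau_f M) z) * vel M z $ j
      + tau_f M z * (pd (e i) (\<lambda>y. beta M y $ i) z * vel M z $ j)
      + tau_f M z * (beta M z $ i * du i j z)" for i j
    unfolding relax_flux_def using pdiff_space_fields[OF z] pdiff_beta[OF z]
    by (simp add: pd_mult pdiff_mult algebra_simps)
  have "(\<Sum>i\<in>UNIV. pd (e i) (\<lambda>y. relax_flux j i y) z)
      = (beta M z \<bullet> grad (tau_f M) z) * vel M z $ j + tau_f M z * (\<Sum>i\<in>UNIV. beta M z $ i * du i j z)" for j
    unfolding A' sum.distrib inner_vec_def grad_def ddx_eq_pd
    using dvg_beta[OF z] by (simp flip: sum_distrib_left sum_distrib_right)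
  then have 2: "(\<Sum>j\<in>UNIV. (\<Sum>i\<in>UNIV. pd (e i) (\<lambda>y. relax_flux j i y) z) * mag M z $ j)
      = (mag M z \<bullet> vel M z) * (beta M z \<bullet> grad (tau_f M) z) + tau_f M z * s2"
  proof -
    assume *: "\<And>j. (\<Sum>i\<in>UNIV. pd (e i) (\<lambda>y. relax_flux j i y) z)
      = (beta M z \<bullet> grad (tau_f M) z) * vel M z $ j + tau_f M z * (\<Sum>i\<in>UNIV. beta M z $ i * du i j z)"
    have s2: "s2 = (\<Sum>j\<in>UNIV. (\<Sum>i\<in>UNIV. beta M z $ i * du i j z) * mag M z $ j)"
      unfolding s2_def sum_swap_distrib[symmetric] by (simp add: mult_ac)
    have mu: "mag M z \<bullet> vel M z = (\<Sum>j\<in>UNIV. mag M z $ j * vel M z $ j)"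
      by (simp add: inner_vec_def)
    show ?thesis
      unfolding * s2 mu by (simp add: sum.distrib sum_distrib_left sum_distrib_right algebra_simps)
  qed
  have "(norm (beta M z))\<^sup>2 = (\<Sum>j\<in>UNIV. (\<Sum>i\<in>UNIV. du i i z * mag M z $ j + vel M z $ i * dB i j z
    - (dB i i z * vel M z $ j + mag M z $ i * du i j z)) * beta M z $ j)"
    by (subst beta_nth[OF z, symmetric]) (simp add: power2_norm_eq_inner inner_vec_def)
  also have "\<dots> = (\<Sum>j\<in>UNIV. dvg (vel M) z * (beta M z $ j * mag M z $ j)
      + (\<Sum>i\<in>UNIV. vel M z $ i * dB i j z) * beta M z $ j
      - (\<Sum>i\<in>UNIV. mag M z $ i * du i j z) * beta M z $ j)"
    using div_mag[OF z] unfolding div_u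
    by (simp add: sum.distrib sum_subtractf algebra_simps flip: sum_distrib_left sum_distrib_right)
  also have "\<dots> = dvg (vel M) z * (beta M z \<bullet> mag M z) + s1 - s3"
    unfolding sum.distrib sum_subtractf sum_distrib_left[symmetric] sum_swap_distrib[symmetric]
      s1_def s3_def inner_vec_def by (simp add: mult_ac)
  finally have nb: "(norm (beta M z))\<^sup>2 = dvg (vel M) z * (beta M z \<bullet> mag M z) + s1 - s3" .
  show ?thesis
    unfolding 1 2 3 nb by (simp add: algebra_simps)
qed

text \<open>Both the stress power and the squared strain reduce to \<open>q1\<close>, the square of
  grad u, and \<open>q2\<close>, its contraction with its transpose.\<close>

lemma Pi_NS_dissipation:
  "(\<Sum>i\<in>UNIV. \<Sum>j\<in>UNIV. Pi_NS M z $ i $ j * du i j z)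
    + kap_f M z / temp M z * (norm (grad (temp M) z))\<^sup>2 = Xi_NS0 M z"
proof -
  define q1 where "q1 = (\<Sum>i\<in>UNIV. \<Sum>j\<in>UNIV. du i j z * du i j z)"
  define q2 where "q2 = (\<Sum>i\<in>UNIV. \<Sum>j\<in>UNIV. du i j z * du j i z)"
  have q1': "(\<Sum>i\<in>UNIV. \<Sum>j\<in>UNIV. du j i z * du j i z) = q1"
    unfolding q1_def by (rule sum.swap)
  have st: "strain M z $ i $ j = (du i j z + du j i z) / 2" for i j
    by (simp add: strain_def grad_vec_def transpose_def ddx_eq_pd)
  have "(\<Sum>i\<in>UNIV. \<Sum>j\<in>UNIV. strain M z $ i $ j * strain M z $ i $ j)
      = (\<Sum>i\<in>UNIV. \<Sum>j\<in>UNIV. 1/4 * (du i j z * du i j z) + 1/2 * (du i j z * du j i z)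
          + 1/4 * (du j i z * du j i z))"
    unfolding st by (intro sum.cong refl) (simp add: field_simps)
  also have "\<dots> = 1/2 * q1 + 1/2 * q2"
    unfolding sum.distrib sum_distrib_left[symmetric] q1' q1_def[symmetric] q2_def[symmetric] by simp
  finally have D: "(\<Sum>i\<in>UNIV. \<Sum>j\<in>UNIV. strain M z $ i $ j * strain M z $ i $ j) = 1/2 * q1 + 1/2 * q2" .
  have "(\<Sum>i\<in>UNIV. \<Sum>j\<in>UNIV. Pi_NS M z $ i $ j * du i j z)
    = (\<Sum>i\<in>UNIV. \<Sum>j\<in>UNIV. mu_f M z * (du i j z * du i j z) + mu_f M z * (du i j z * du j i z)
      + (lam_f M z * dvg (vel M) z - 2/3 * mu_f M z * dvg (vel M) z) * ((mat 1 :: real^'n^'n) $ i $ j * du i j z))"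
    unfolding Pi_NS_nth div_u by (intro sum.cong refl) (simp add: algebra_simps)
  also have "\<dots> = mu_f M z * q1 + mu_f M z * q2
      + (lam_f M z * dvg (vel M) z - 2/3 * mu_f M z * dvg (vel M) z) * dvg (vel M) z"
    unfolding sum.distrib sum_distrib_left[symmetric] sum_mat_1 q1_def q2_def div_u by simp
  finally show ?thesis
    unfolding Xi_NS0_def D by (simp add: algebra_simps power2_eq_square)
qed

text \<open>The beta.B part of the isotropic coefficient is split off because it belongs with
  \<open>magnetic_dissipation\<close>; the rest of that coefficient feeds
  \<open>entropy_production_identity\<close>.\<close>

lemma Pi_dissipation:
  "(\<Sum>i\<in>UNIV. \<Sum>j\<in>UNIV. Pi_tensor M z $ i $ j * du i j z)
    = (\<Sum>i\<in>UNIV. \<Sum>j\<in>UNIV. Pi_NS M z $ i $ j * du i j z)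
    + rho M z * (w_hat M z \<bullet> advect (vel M) (vel M z) z)
    - tau_f M z * (\<Sum>i\<in>UNIV. \<Sum>j\<in>UNIV. (beta M z $ i * mag M z $ j + mag M z $ i * beta M z $ j) * du i j z)
    + tau_f M z * (beta M z \<bullet> mag M z) * dvg (vel M) z
    + tau_f M z * (vel M z \<bullet> grad (pres_f M) z + rho M z * Cs2_f M z * dvg (vel M) z
        - pres_theta_f M z / (rho M z * eps_theta_f M z) * heat M z) * dvg (vel M) z"
proof -
  let ?G = "vel M z \<bullet> grad (pres_f M) z + rho M z * Cs2_f M z * dvg (vel M) z + beta M z \<bullet> mag M z
        - pres_theta_f M z / (rho M z * eps_theta_f M z) * heat M z"
  have "(\<Sum>i\<in>UNIV. \<Sum>j\<in>UNIV. Pi_tensor M z $ i $ j * du i j z)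
    = (\<Sum>i\<in>UNIV. \<Sum>j\<in>UNIV. Pi_NS M z $ i $ j * du i j z
      + rho M z * ((vel M z $ i * du i j z) * w_hat M z $ j)
      - tau_f M z * ((beta M z $ i * mag M z $ j + mag M z $ i * beta M z $ j) * du i j z)
      + (tau_f M z * ?G) * ((mat 1 :: real^'n^'n) $ i $ j * du i j z))"
    by (intro sum.cong refl) (simp add: Pi_tensor_def outer_def algebra_simps)
  also have "\<dots> = (\<Sum>i\<in>UNIV. \<Sum>j\<in>UNIV. Pi_NS M z $ i $ j * du i j z)
    + rho M z * (\<Sum>j\<in>UNIV. (\<Sum>i\<in>UNIV. vel M z $ i * du i j z) * w_hat M z $ j)
    - tau_f M z * (\<Sum>i\<in>UNIV. \<Sum>j\<in>UNIV. (beta M z $ i * mag M z $ j + mag M z $ i * beta M z $ j) * du i j z)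
    + (tau_f M z * ?G) * dvg (vel M) z"
    unfolding sum.distrib sum_subtractf sum_distrib_left[symmetric] sum_mat_1 div_u
      sum_swap_distrib[where g="\<lambda>j. w_hat M z $ j"] ..
  also have "(\<Sum>j\<in>UNIV. (\<Sum>i\<in>UNIV. vel M z $ i * du i j z) * w_hat M z $ j)
      = w_hat M z \<bullet> advect (vel M) (vel M z) z"
    by (simp add: advect_def grad_vec_def inner_vec_def ddx_eq_pd mult.commute)
  finally show ?thesis by (simp add: algebra_simps)
qed

end

section \<open>Entropy balance and entropy production\<close>

text \<open>Cauchy-Schwarz on the diagonal against the constant 1. The dimension enters as its
  constant, which is where the restriction to n at most 3 comes from.\<close>

lemma sum_diag_squares_le:
  fixes D :: "'n::finite \<Rightarrow> 'n \<Rightarrow> real"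
  shows "(\<Sum>i\<in>UNIV. D i i)\<^sup>2 \<le> CARD('n) * (\<Sum>i\<in>UNIV. \<Sum>j\<in>UNIV. D i j * D i j)"
proof -
  have "(\<Sum>i\<in>UNIV. D i i)\<^sup>2 \<le> CARD('n) * (\<Sum>i\<in>UNIV. (D i i)\<^sup>2)"
    using Cauchy_Schwarz_ineq_sum[of "\<lambda>_. 1" "\<lambda>i. D i i" "UNIV :: 'n set"] by simp
  also have "(\<Sum>i\<in>UNIV. (D i i)\<^sup>2) \<le> (\<Sum>i\<in>UNIV. \<Sum>j\<in>UNIV. D i j * D i j)"
    by (intro sum_mono) (simp add: power2_eq_square member_le_sum[of _ UNIV "\<lambda>j. D _ j * D _ j"])
  finally show ?thesis by (simp add: mult_left_mono)
qed

text \<open>In \<open>x = div (\<rho> u)\<close> and the second square's argument \<open>y\<close>, both sides are the same quadratic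
  form, the left one diagonalized as \<open>(p\<^sub>\<rho> x + p\<^sub>\<theta> y)\<^sup>2\<close> and \<open>(\<epsilon>\<^sub>\<theta> y / \<theta> - p\<^sub>\<theta> x / \<rho>\<^sup>2)\<^sup>2\<close>.\<close>

lemma specific_heat_identity:
  fixes r th pr pth eth Q d a rr ta C :: real
  assumes "r > 0" "th > 0" "eth > 0" "pr > 0"
    and C: "C = pr + th * pth\<^sup>2 / (r\<^sup>2 * eth)"
  shows "ta / (r * C) * (r * C * d + (rr * pr + a * pth) - pth * Q / (2 * r * eth))\<^sup>2
      + ta * r * th / (eth * C / pr) * ((a * eth - rr * th * pth / r\<^sup>2) / th - Q / (2 * r * th))\<^sup>2
    = ta * pr / r * (rr + r * d)\<^sup>2
      + ta * r * eth / th * (th * pth / (r * eth) * d + a - Q / (2 * r * eth))\<^sup>2"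
proof -
  define x where "x = rr + r * d"
  define y where "y = th * pth / (r * eth) * d + a - Q / (2 * r * eth)"
  have C0: "C > 0" unfolding C using assms(1-4) by (intro add_pos_nonneg) auto
  have 1: "r * C * d + (rr * pr + a * pth) - pth * Q / (2 * r * eth) = pr * x + pth * y"
    unfolding x_def y_def C using assms(1-3) by (simp add: field_simps power2_eq_square)
  have 2: "(a * eth - rr * th * pth / r\<^sup>2) / th - Q / (2 * r * th) = eth / th * y - pth / r\<^sup>2 * x"
    unfolding x_def y_def using assms(1-3) by (simp add: field_simps power2_eq_square)
  have rC: "r\<^sup>2 * eth * C = r\<^sup>2 * eth * pr + th * pth\<^sup>2"
    unfolding C using assms(1-3) by (simp add: field_simps)
  \<comment> \<open>With c_p written as \<open>eth * C / pr\<close>, both weights contain the common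
    factor \<open>ta / (r * eth * C)\<close>.\<close>
  have 3: "ta / (r * C) * X + ta * r * th / (eth * C / pr) * Y = ta / (r * eth * C) * (eth * X + r\<^sup>2 * th * pr * Y)"
    for X Y
    using assms(1-4) C0 by (simp add: field_simps power2_eq_square)
  \<comment> \<open>With these weights the products \<open>x * y\<close> cancel, and the
    coefficients of \<open>x\<^sup>2\<close> and \<open>y\<^sup>2\<close> share the factor that
    \<open>rC\<close> identifies as \<open>r\<^sup>2 * eth * C\<close>, cancelling the
    denominator.\<close>
  have "eth * (pr * x + pth * y)\<^sup>2 + r\<^sup>2 * th * pr * (eth / th * y - pth / r\<^sup>2 * x)\<^sup>2
      = (r\<^sup>2 * eth * pr + th * pth\<^sup>2) * (pr * x\<^sup>2 / r\<^sup>2 + eth * y\<^sup>2 / th)"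
    using assms(1-3) by (simp add: field_simps power2_eq_square)
  then have "ta / (r * C) * (pr * x + pth * y)\<^sup>2
      + ta * r * th / (eth * C / pr) * (eth / th * y - pth / r\<^sup>2 * x)\<^sup>2
    = ta / (r * eth * C) * (r\<^sup>2 * eth * C * (pr * x\<^sup>2 / r\<^sup>2 + eth * y\<^sup>2 / th))"
    unfolding 3 rC by simp
  also have "\<dots> = ta * pr / r * x\<^sup>2 + ta * r * eth / th * y\<^sup>2"
    using assms(1-3) C0 by (simp add: field_simps power2_eq_square)
  finally show ?thesis unfolding 1 2 x_def y_def .
qed

context mgd_flow begin

lemma vel_grad_pres:
  assumes z: "z \<in> S"
  shows "vel M z \<bullet> grad (pres_f M) z = (vel M z \<bullet> grad (rho M) z) * pres_rho_f M z
    + (vel M z \<bullet> grad (temp M) z) * pres_theta_f M z"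
  unfolding inner_vec_def grad_def ddx_eq_pd
  by (simp add: pd_pres_f[OF z space_dir_Basis] sum.distrib sum_distrib_right distrib_left mult.assoc)

lemma vel_grad_eps:
  assumes z: "z \<in> S"
  shows "vel M z \<bullet> grad (eps_f M) z
    = (vel M z \<bullet> grad (rho M) z) * (pres_f M z - temp M z * pres_theta_f M z) / (rho M z)\<^sup>2
    + (vel M z \<bullet> grad (temp M) z) * eps_theta_f M z"
  unfolding inner_vec_def grad_def ddx_eq_pd
  by (simp add: pd_eps_f[OF z space_dir_Basis] sum.distrib sum_distrib_right sum_divide_distrib
      distrib_left mult.assoc)

lemma div_rho_u_eq: "div_rho_u z = vel M z \<bullet> grad (rho M) z + rho M z * dvg (vel M) z"
  unfolding inner_vec_def grad_def ddx_eq_pd div_u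
  by (simp add: sum.distrib sum_distrib_left mult.commute)

text \<open>Moving 1/theta inside the divergence of the flux costs q.grad(theta) / theta^2. Its
  conductive part supplies the \<open>kap_f\<close> term of \<open>Xi_NS0\<close>, its relaxation
  part the heat flux term of \<open>entropy_production_identity\<close>.\<close>

lemma entropy_balance:
  assumes z: "z \<in> S"
  shows "ddt (\<lambda>y. rho M y * entropy_f M s y) z
        + dvg (\<lambda>y. (rho M y * entropy_f M s y) *\<^sub>R (vel M y - w_reg M y)) z
        = dvg (\<lambda>y. (1 / temp M y) *\<^sub>R (- q_flux M y)) z + 1 / temp M z * Xi M z"
proof -
  define c where "c = (\<lambda>i y. vel M y $ i - w_reg M y $ i)"
  define dv where "dv = (\<Sum>i\<in>UNIV. du i i z - dw i i z)"
  define dq where "dq = dvg (\<lambda>y. - q_flux M y) z"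
  define r where "r = rho M z"
  define th where "th = temp M z"
  define p where "p = pres_f M z"
  define ta where "ta = tau_f M z"
  define Q where "Q = heat M z"
  define d where "d = dvg (vel M) z"
  define rr where "rr = vel M z \<bullet> grad (rho M) z"
  define a where "a = vel M z \<bullet> grad (temp M) z"
  define cr where "cr = (\<Sum>i\<in>UNIV. c i z * pd (e i) (rho M) z)"
  define ce where "ce = (\<Sum>i\<in>UNIV. c i z * pd (e i) (eps_f M) z)"
  define rt where "rt = pd (0, 1) (rho M) z"
  define et where "et = pd (0, 1) (eps_f M) z"
  note P = pos[OF z]
  have c: "pdiff (e k) (c i) z" "pd (e k) (c i) z = du k i z - dw k i z" for k i
    unfolding c_def using z by (simp_all add: pd_diff pdiff_diff pdiff_space_fields pdiff_w_reg)
  have mass: "rt + cr + r * dv = 0"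
    using mass_expanded[OF z] unfolding rt_def cr_def dv_def c_def r_def .
  have "ddt (\<lambda>y. rho M y * entropy_f M s y) z
      = rt * entropy_f M s z + r * ((et - p / r\<^sup>2 * rt) / th)"
    unfolding ddt_eq_pd pd_mult[OF pdiff_time_fields(1)[OF z] pdiff_time_fields(7)[OF z]]
      pd_entropy[OF z time_dir_Basis] rt_def et_def p_def r_def th_def ..
  moreover have "dvg (\<lambda>y. (rho M y * entropy_f M s y) *\<^sub>R (vel M y - w_reg M y)) z
      = entropy_f M s z * (cr + r * dv) + r * ((ce - p / r\<^sup>2 * cr) / th)"
  proof -
    have t: "pd (e i) (\<lambda>y. rho M y * entropy_f M s y * c i y) z
      = entropy_f M s z * (c i z * pd (e i) (rho M) z) + entropy_f M s z * (r * (du i i z - dw i i z))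
        + (r / th) * (c i z * pd (e i) (eps_f M) z) - (r / th * (p / r\<^sup>2)) * (c i z * pd (e i) (rho M) z)"
      for i
    proof -
      have "pd (e i) (\<lambda>y. rho M y * entropy_f M s y * c i y) z
        = (pd (e i) (rho M) z * entropy_f M s z + rho M z *
            ((pd (e i) (eps_f M) z - pres_f M z / (rho M z)\<^sup>2 * pd (e i) (rho M) z) / temp M z)) * c i z
          + rho M z * entropy_f M s z * (du i i z - dw i i z)"
        unfolding pd_entropy[OF z space_dir_Basis, symmetric]
        using pdiff_space_fields[OF z] c by (simp only: pd_mult pdiff_mult)
      then show ?thesis
        unfolding r_def th_def p_def using P(1,2) by (simp add: divide_simps) (simp add: algebra_simps)
    qed
    have "dvg (\<lambda>y. (rho M y * entropy_f M s y) *\<^sub>R (vel M y - w_reg M y)) z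
      = (\<Sum>i\<in>UNIV. pd (e i) (\<lambda>y. rho M y * entropy_f M s y * c i y) z)"
      by (simp add: dvg_def ddx_eq_pd c_def)
    also have "\<dots> = entropy_f M s z * cr + entropy_f M s z * (r * dv) + (r / th) * ce
        - (r / th * (p / r\<^sup>2)) * cr"
      unfolding t cr_def ce_def dv_def by (simp only: sum.distrib sum_subtractf sum_distrib_left right_diff_distrib)
    finally show ?thesis by (simp add: algebra_simps diff_divide_distrib)
  qed
  ultimately have lhs: "ddt (\<lambda>y. rho M y * entropy_f M s y) z
        + dvg (\<lambda>y. (rho M y * entropy_f M s y) *\<^sub>R (vel M y - w_reg M y)) z
      = (r * (et + ce) + p * dv) / th"
  proof -
    have r: "r > 0" "th > 0" unfolding r_def th_def using P by auto
    \<comment> \<open>Eliminating the time derivative of the density cancels all terms with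
      undifferentiated entropy and turns the Gibbs term \<open>- p / r\<^sup>2 * (rt + cr)\<close>
      into \<open>p * dv / r\<close>.\<close>
    have rt: "rt = - cr - r * dv" using mass by simp
    show ?thesis
      unfolding \<open>ddt _ z = _\<close> \<open>dvg _ z = _\<close> rt using r
      by (simp add: divide_simps) (simp add: algebra_simps power2_eq_square)
  qed
  have "dvg (\<lambda>y. (1 / temp M y) *\<^sub>R (- q_flux M y)) z
      = (\<Sum>i\<in>UNIV. 1 / th * pd (e i) (\<lambda>y. - q_flux M y $ i) z + 1 / th\<^sup>2 * (q_flux M z $ i * pd (e i) (temp M) z))"
  proof -
    have "pd (e i) (\<lambda>y. 1 / temp M y * (- q_flux M y $ i)) z
      = (- pd (e i) (temp M) z / (temp M z)\<^sup>2) * (- q_flux M z $ i) + 1 / temp M z * pd (e i) (\<lambda>y. - q_flux M y $ i) z"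
      for i
      using P(2) pdiff_space_fields[OF z] pdiff_q_flux[OF z]
      by (subst pd_mult) (auto intro: pdiff_inverse pdiff_minus simp: pd_inverse)
    then show ?thesis
      unfolding dvg_def ddx_eq_pd th_def by (simp add: algebra_simps)
  qed
  also have "\<dots> = dq / th + (q_flux M z \<bullet> grad (temp M) z) / th\<^sup>2"
    unfolding sum.distrib sum_distrib_left[symmetric] dq_def dvg_def ddx_eq_pd inner_vec_def grad_def
    by simp
  also have "q_flux M z \<bullet> grad (temp M) z = - kap_f M z * (norm (grad (temp M) z))\<^sup>2
      - ta * (r * (vel M z \<bullet> grad (eps_f M) z - p / r\<^sup>2 * rr) - Q) * a"
    unfolding q_flux_def ta_def r_def p_def rr_def Q_def a_def
    by (simp add: inner_simps power2_norm_eq_inner algebra_simps)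
  finally have flux: "dvg (\<lambda>y. (1 / temp M y) *\<^sub>R (- q_flux M y)) z
      = dq / th + (- kap_f M z * (norm (grad (temp M) z))\<^sup>2
      - ta * (r * (vel M z \<bullet> grad (eps_f M) z - p / r\<^sup>2 * rr) - Q) * a) / th\<^sup>2" .
  \<comment> \<open>The internal energy balance, arranged so that \<open>Xi M z\<close> is isolated
    and the other terms, divided by \<open>th\<close>, are exactly those of
    \<open>flux\<close>.\<close>
  have heat: "r * (et + ce) + p * dv = dq
      + kap_f M z / th * (- (norm (grad (temp M) z))\<^sup>2)
      - ta * (r * (vel M z \<bullet> grad (eps_f M) z - p / r\<^sup>2 * rr) - Q) * a / th + Xi M z"
  proof -
    have "ta * (vel M z \<bullet> grad (pres_f M) z + r * Cs2_f M z * d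
          - pres_theta_f M z / (r * eps_theta_f M z) * Q) * d
        + ta / r * (rr + r * d) * (vel M z \<bullet> grad (pres_f M) z)
        + ta * (r * (vel M z \<bullet> grad (eps_f M) z - p / r\<^sup>2 * rr) - Q) * a / th + Q
      = ta * pres_rho_f M z / r * (rr + r * d)\<^sup>2
        + ta * r * eps_theta_f M z / th * (th * pres_theta_f M z / (r * eps_theta_f M z) * d + a
            - Q / (2 * r * eps_theta_f M z))\<^sup>2
        + Q * (1 - ta * Q / (4 * r * th * eps_theta_f M z))"
      unfolding r_def th_def rr_def a_def p_def
      by (rule entropy_production_identity[OF P(1-3) vel_grad_pres[OF z] vel_grad_eps[OF z] Cs2_f_def])
    then show ?thesis
      using heat_balance[OF z] magnetic_dissipation[OF z] Pi_NS_dissipation[of z] Pi_dissipation[of z]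
      unfolding Xi_def dvg_rho_vel[OF z] div_rho_u_eq
      unfolding r_def[symmetric] th_def[symmetric] rr_def[symmetric] a_def[symmetric]
        p_def[symmetric] ta_def[symmetric] Q_def[symmetric] d_def[symmetric] et_def[symmetric]
        dv_def[symmetric] dq_def[symmetric] ce_def[symmetric, unfolded c_def]
      by linarith
  qed
  define G where "G = r * (vel M z \<bullet> grad (eps_f M) z - p / r\<^sup>2 * rr) - Q"
  have "th > 0" unfolding th_def by (rule P(2))
  then show ?thesis
    unfolding lhs flux heat G_def[symmetric] th_def[symmetric]
    by (simp add: field_simps power2_eq_square)
qed

text \<open>The trace of the strain is div u, so the terms with mu are 2 mu times the squared strain
  minus a third of its squared trace.\<close>

lemma Xi_NS0_nonneg:
  assumes z: "z \<in> S" and n: "CARD('n) \<in> {1, 2, 3}"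
  shows "Xi_NS0 M z \<ge> 0"
proof -
  define D where "D = (\<Sum>i\<in>UNIV. \<Sum>j\<in>UNIV. strain M z $ i $ j * strain M z $ i $ j)"
  note P = pos[OF z]
  have "D \<ge> 0" unfolding D_def by (intro sum_nonneg) auto
  have "dvg (vel M) z = (\<Sum>i\<in>UNIV. strain M z $ i $ i)"
    by (simp add: strain_def grad_vec_def transpose_def ddx_eq_pd div_u)
  then have "(dvg (vel M) z)\<^sup>2 \<le> CARD('n) * D"
    unfolding D_def using sum_diag_squares_le[of "\<lambda>i j. strain M z $ i $ j"] by simp
  also have "\<dots> \<le> 3 * D" using n \<open>D \<ge> 0\<close> by (intro mult_right_mono) auto
  finally have "mu_f M z * (2 * D - 2/3 * (dvg (vel M) z)\<^sup>2) \<ge> 0"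
    using P(8) by (intro mult_nonneg_nonneg) auto
  moreover have "lam_f M z * (dvg (vel M) z)\<^sup>2 \<ge> 0" "kap_f M z / temp M z * (norm (grad (temp M) z))\<^sup>2 \<ge> 0"
    using P by auto
  moreover have "Xi_NS0 M z = mu_f M z * (2 * D - 2/3 * (dvg (vel M) z)\<^sup>2)
      + lam_f M z * (dvg (vel M) z)\<^sup>2 + kap_f M z / temp M z * (norm (grad (temp M) z))\<^sup>2"
    unfolding Xi_NS0_def D_def by (simp add: algebra_simps)
  ultimately show ?thesis by linarith
qed

lemma Xi_specific_heat_form:
  assumes z: "z \<in> S" and pr: "pres_rho_f M z > 0"
  shows "Xi M z =
            Xi_NS0 M z
            + rho M z / tau_f M z * (norm (w_hat M z))\<^sup>2
            + tau_f M z / (rho M z * Cs2_f M z) *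
                (rho M z * Cs2_f M z * dvg (vel M) z + vel M z \<bullet> grad (pres_f M) z
                 - pres_theta_f M z * heat M z / (2 * rho M z * eps_theta_f M z))\<^sup>2
            + tau_f M z * rho M z * temp M z / cp_f M z *
                (vel M z \<bullet> grad (entropy_f M s) z - heat M z / (2 * rho M z * temp M z))\<^sup>2
            + tau_f M z * (norm (beta M z))\<^sup>2
            + (mag M z \<bullet> vel M z) * (beta M z \<bullet> grad (tau_f M) z)
            + heat M z * (1 - tau_f M z * heat M z
                                / (4 * rho M z * temp M z * eps_theta_f M z))"
proof -
  note P = pos[OF z]
  have "vel M z \<bullet> grad (entropy_f M s) z
      = (vel M z \<bullet> grad (eps_f M) z - pres_f M z / (rho M z)\<^sup>2 * (vel M z \<bullet> grad (rho M) z)) / temp M z"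
    unfolding inner_vec_def grad_def ddx_eq_pd
    by (simp add: pd_entropy[OF z space_dir_Basis] sum_subtractf sum_distrib_left sum_divide_distrib
        right_diff_distrib diff_divide_distrib mult_ac)
  \<comment> \<open>The Maxwell relation cancels the pressure from the Gibbs relation and leaves
    only p_theta.\<close>
  also have "\<dots> = ((vel M z \<bullet> grad (temp M) z) * eps_theta_f M z
      - (vel M z \<bullet> grad (rho M) z) * temp M z * pres_theta_f M z / (rho M z)\<^sup>2) / temp M z"
    unfolding vel_grad_eps[OF z] using P by (simp add: field_simps)
  finally have s: "vel M z \<bullet> grad (entropy_f M s) z = \<dots>" .
  show ?thesis
    unfolding Xi_def s vel_grad_pres[OF z] cp_f_def dvg_rho_vel[OF z] div_rho_u_eq
    using specific_heat_identity[OF P(1-3) pr Cs2_f_def, of "tau_f M z" "dvg (vel M) z"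
        "vel M z \<bullet> grad (rho M) z" "vel M z \<bullet> grad (temp M) z" "heat M z"] by linarith
qed

text \<open>Constant tau removes the one summand with no definite sign, the product with grad tau;
  the bound on Q makes the last summand nonnegative.\<close>

lemma Xi_nonneg:
  assumes const: "tau_f M constant_on S" and z: "z \<in> S" and n: "CARD('n) \<in> {1, 2, 3}"
    and Q: "tau_f M z * heat M z / (4 * rho M z * temp M z * eps_theta_f M z) \<le> 1"
  shows "Xi M z \<ge> 0"
proof -
  note P = pos[OF z]
  from const obtain k where "\<And>y. y \<in> S \<Longrightarrow> tau_f M y = k" unfolding constant_on_def by auto
  then have "grad (tau_f M) z = 0"
    unfolding grad_def ddx_eq_pd vec_eq_iff using pd_cong[OF open_S z, of "tau_f M" "\<lambda>_. k"] by simp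
  then show ?thesis
    unfolding Xi_def using P Q Xi_NS0_nonneg[OF z n]
    by (auto intro!: add_nonneg_nonneg mult_nonneg_nonneg divide_nonneg_nonneg)
qed

end

theorem proposition3:
  fixes M :: "'n::finite mgd" and \<Omega> :: "(real^'n) set" and T :: real
    and s :: "real \<times> real \<Rightarrow> real"
  assumes "open \<Omega>" and "connected \<Omega>" and "\<Omega> \<noteq> {}" and "0 < T"
    and "state_equations M" and "coefficients M" and "sources \<Omega> T M"
    and "mgd_solution \<Omega> T M"
    and "is_entropy M s"
  shows
    "(\<forall>z\<in>cylinder \<Omega> T.
        ddt (\<lambda>y. rho M y * entropy_f M s y) z
        + dvg (\<lambda>y. (rho M y * entropy_f M s y) *\<^sub>R (vel M y - w_reg M y)) z
        = dvg (\<lambda>y. (1 / temp M y) *\<^sub>R (- q_flux M y)) z + 1 / temp M z * Xi M z)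
     \<and> (CARD('n) \<in> {1, 2, 3} \<longrightarrow> (\<forall>z\<in>cylinder \<Omega> T. Xi_NS0 M z \<ge> 0))
     \<and> (\<forall>z\<in>cylinder \<Omega> T. pres_rho_f M z > 0 \<longrightarrow>
          Cs2_f M z / pres_rho_f M z = cp_f M z / cv_f M z \<and>
          Xi M z =
            Xi_NS0 M z
            + rho M z / tau_f M z * (norm (w_hat M z))\<^sup>2
            + tau_f M z / (rho M z * Cs2_f M z) *
                (rho M z * Cs2_f M z * dvg (vel M) z + vel M z \<bullet> grad (pres_f M) z
                 - pres_theta_f M z * heat M z / (2 * rho M z * eps_theta_f M z))\<^sup>2
            + tau_f M z * rho M z * temp M z / cp_f M z *
                (vel M z \<bullet> grad (entropy_f M s) z - heat M z / (2 * rho M z * temp M z))\<^sup>2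
            + tau_f M z * (norm (beta M z))\<^sup>2
            + (mag M z \<bullet> vel M z) * (beta M z \<bullet> grad (tau_f M) z)
            + heat M z * (1 - tau_f M z * heat M z
                                / (4 * rho M z * temp M z * eps_theta_f M z)))
     \<and> (tau_f M constant_on cylinder \<Omega> T \<longrightarrow>
        (\<forall>z\<in>cylinder \<Omega> T.
           tau_f M z * heat M z / (4 * rho M z * temp M z * eps_theta_f M z) \<le> 1) \<longrightarrow>
        CARD('n) \<in> {1, 2, 3} \<longrightarrow>
        (\<forall>z\<in>cylinder \<Omega> T. 1 / temp M z * Xi M z \<ge> 0))"
proof -
  interpret mgd_flow M \<Omega> T s
    using assms(1,5-9) by unfold_locales
  show ?thesis
  proof (intro conjI impI ballI)
    fix z assume z: "z \<in> cylinder \<Omega> T"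
    show "ddt (\<lambda>y. rho M y * entropy_f M s y) z
        + dvg (\<lambda>y. (rho M y * entropy_f M s y) *\<^sub>R (vel M y - w_reg M y)) z
        = dvg (\<lambda>y. (1 / temp M y) *\<^sub>R (- q_flux M y)) z + 1 / temp M z * Xi M z"
      by (rule entropy_balance[OF z])
    show "Xi_NS0 M z \<ge> 0" if "CARD('n) \<in> {1, 2, 3}"
      by (rule Xi_NS0_nonneg[OF z that])
    show "1 / temp M z * Xi M z \<ge> 0"
      if "tau_f M constant_on cylinder \<Omega> T"
        "\<forall>z\<in>cylinder \<Omega> T. tau_f M z * heat M z / (4 * rho M z * temp M z * eps_theta_f M z) \<le> 1"
        "CARD('n) \<in> {1, 2, 3}"
      using Xi_nonneg[OF that(1) z that(3)] that(2) z pos(2)[OF z] by auto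
    assume pr: "pres_rho_f M z > 0"
    show "Cs2_f M z / pres_rho_f M z = cp_f M z / cv_f M z"
      using pos(3)[OF z] pr unfolding cp_f_def cv_f_def by simp
  qed (rule Xi_specific_heat_form)
qed

end
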